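(* Let $P$ be a path linkage with $k\ge2$ edges, all of positive length. Let $p,q\in M(P)$ be such that neither $\theta(p)$ nor $\theta(q)$ is a critical value of $\theta$. Let $\alpha:[0,1]\to[P]$ be continuous with $\alpha(0)=\theta(p)$ and $\alpha(1)=\theta(q)$. If $\alpha([0,1])\cap\nabla(P)\neq\emptyset$, then there exists a continuous $\tilde\alpha:[0,1]\to M(P)$ with $\tilde\alpha(0)=p$, $\tilde\alpha(1)=q$ and $\theta\circ\tilde\alpha=\alpha$.
   Context: A path linkage is a linkage $P=(G,l)$ where $G$ is a path graph with vertices $1,\dots,k+1$ and edges $\{i,i+1\}$, $l$ assigning lengths to edges; its terminal vertices are $s=1$, $t=k+1$. $C(P)=\{p:V\to\mathbb R^2:|p(u)-p(v)|=l(\{u,v\})\text{ for every edge}\}$, and $M(P)$ is the quotient of $C(P)$ (subspace topology from $\mathbb R^{2|V|}$) by the group of orientation preserving isometries of $\mathbb R^2$, with the quotient topology. $\theta:M(P)\to\mathbb R$, $\theta(p)=|p(s)-p(t)|$, and $[P]=\theta(M(P))$. A point $p\in M(P)$ is a critical point of $\theta$ if $\theta(p)=0$ or all points $p(v)$, $v\in V$, lie on a common affine line in $\mathbb R^2$; a critical value is the image under $\theta$ of a critical point. $\nabla(P)=\{x\in[P]:\theta^{-1}(x)\text{ is connected}\}$. *)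

theory Defs
  imports "HOL-Analysis.Analysis"
begin

text \<open>A path linkage with k edges is given by k and the length function l, where
  l i is the length of edge {i, i+1}, i = 1..k. Vertices are 1..k+1, s = 1, t = k+1.
  The plane R^2 is identified with the complex numbers; a placement is a map
  nat => complex that is 0 outside the vertex set (so the space of placements is
  a copy of R^(2|V|) with its usual topology, i.e. the product topology).\<close>

definition verts :: "nat \<Rightarrow> nat set" where
  "verts k = {1..k+1}"

definition conf_space :: "nat \<Rightarrow> (nat \<Rightarrow> real) \<Rightarrow> (nat \<Rightarrow> complex) set" where
  "conf_space k l = {p. (\<forall>v. v \<notin> verts k \<longrightarrow> p v = 0) \<and>
                        (\<forall>i\<in>{1..k}. cmod (p i - p (i+1)) = l i)}"

text \<open>Orientation preserving isometries of the plane are exactly z \<mapsto> a*z + b with |a| = 1.\<close>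
definition or_isometry :: "(complex \<Rightarrow> complex) \<Rightarrow> bool" where
  "or_isometry g \<longleftrightarrow> (\<exists>a b. cmod a = 1 \<and> (\<forall>z. g z = a * z + b))"

definition conf_rel :: "nat \<Rightarrow> (nat \<Rightarrow> real) \<Rightarrow> ((nat \<Rightarrow> complex) \<times> (nat \<Rightarrow> complex)) set" where
  "conf_rel k l = {(p, q). p \<in> conf_space k l \<and> q \<in> conf_space k l \<and>
                    (\<exists>g. or_isometry g \<and> (\<forall>v\<in>verts k. q v = g (p v)))}"

definition moduli :: "nat \<Rightarrow> (nat \<Rightarrow> real) \<Rightarrow> (nat \<Rightarrow> complex) set set" where
  "moduli k l = conf_space k l // conf_rel k l"

definition quotient_topology :: "'a topology \<Rightarrow> ('a \<Rightarrow> 'b) \<Rightarrow> 'b set \<Rightarrow> 'b topology" where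
  "quotient_topology X f S =
     topology (\<lambda>U. U \<subseteq> S \<and> openin X {x \<in> topspace X. f x \<in> U})"

definition moduli_top :: "nat \<Rightarrow> (nat \<Rightarrow> real) \<Rightarrow> (nat \<Rightarrow> complex) set topology" where
  "moduli_top k l = quotient_topology (top_of_set (conf_space k l))
                       (\<lambda>p. conf_rel k l `` {p}) (moduli k l)"

definition rep :: "(nat \<Rightarrow> complex) set \<Rightarrow> (nat \<Rightarrow> complex)" where
  "rep X = (SOME p. p \<in> X)"

definition theta :: "nat \<Rightarrow> (nat \<Rightarrow> complex) set \<Rightarrow> real" where
  "theta k X = cmod (rep X 1 - rep X (k+1))"

definition critical_point :: "nat \<Rightarrow> (nat \<Rightarrow> real) \<Rightarrow> (nat \<Rightarrow> complex) set \<Rightarrow> bool" where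
  "critical_point k l X \<longleftrightarrow> X \<in> moduli k l \<and>
     (theta k X = 0 \<or> collinear (rep X ` verts k))"

definition critical_value :: "nat \<Rightarrow> (nat \<Rightarrow> real) \<Rightarrow> real \<Rightarrow> bool" where
  "critical_value k l x \<longleftrightarrow> (\<exists>X. critical_point k l X \<and> theta k X = x)"

definition range_P :: "nat \<Rightarrow> (nat \<Rightarrow> real) \<Rightarrow> real set" where
  "range_P k l = theta k ` moduli k l"

definition nabla :: "nat \<Rightarrow> (nat \<Rightarrow> real) \<Rightarrow> real set" where
  "nabla k l = {x \<in> range_P k l.
      connectedin (moduli_top k l) {X \<in> moduli k l. theta k X = x}}"

end

(* A configuration modulo rigid motions is determined by the lengths d_j of the diagonals from the
   first vertex and by one orientation for each triangle (d_{j-1}, l_j, d_j), as long as no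
   interior diagonal vanishes. The possible sequences d form a convex polytope, so paths of
   diagonals over a given path of values d_k exist by linear interpolation, and an orientation may
   change whenever its triangle is flat. Order the edges so that the first two are the longest.
   Then over every value of theta all triangles but the first can be made flat simultaneously, and
   the only obstruction to joining two configurations is the orientation of the two longest edges.
   This orientation is constant on components of a fibre where these edges are never parallel, and
   it takes both signs there by reflection; so a connected fibre contains a configuration with
   parallel longest edges, at which the first triangle can be flipped. Regularity of the two end
   values is used to leave configurations with vanishing diagonals. *)
theory Submission
  imports Defs "HOL-Combinatorics.Transposition"
begin

text \<open>A class is given by its edge vectors up to a common rotation, and \<open>theta\<close>
  is the modulus of their sum. Both are compatible with permuting the edges, so the lengths may be
  sorted without changing the problem. Why two long edges suffice: descending from
  \<open>d k\<close>, a fold towards \<open>l 1\<close> that overshoots misses \<open>l 1\<close> by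
  at most the length of the folded edge, hence by at most \<open>l 2\<close>, so the remaining edges
  can always close up. A vanishing diagonal is the recurring obstacle, since a triangle on a base of
  length zero has no orientation. It is met in three ways. At the ends, two non-parallel edges
  absorb the free rotation of a third one. At the flipping time, a diagonal of index at least 3 is
  simply replaced by a positive one. The second diagonal cannot be replaced, because it records that
  the first two edges are parallel; it vanishes only for \<open>l 1 = l 2\<close>, and for
  \<open>k \<ge> 3\<close> this case needs its own path through the zero. Finally, a value in
  \<open>nabla\<close> may be attained only at time 0 or 1, where no room is left for a flip;
  parallel edges are then found at a nearby interior time.\<close>

section \<open>Triangles in the plane\<close>

text \<open>The vertex at distance \<open>d\<close> from \<open>0\<close> and \<open>r\<close> from \<open>z\<close>, on the side given by the sign \<open>s\<close>.\<close>
definition tri :: "complex \<Rightarrow> real \<Rightarrow> real \<Rightarrow> real \<Rightarrow> complex" where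
  "tri z d r s = sgn z *
     (of_real ((d\<^sup>2 + (cmod z)\<^sup>2 - r\<^sup>2) / (2 * cmod z)) +
      \<i> * of_real (s * sqrt (d\<^sup>2 - ((d\<^sup>2 + (cmod z)\<^sup>2 - r\<^sup>2) / (2 * cmod z))\<^sup>2)))"

lemma cmod_sq: "(cmod z)\<^sup>2 = (Re z)\<^sup>2 + (Im z)\<^sup>2"
  by (simp add: cmod_def)

text \<open>The triangle inequalities put \<open>r\<close> between \<open>\<bar>n - d\<bar>\<close>
  and \<open>n + d\<close>. Squared, they say that the foot of the altitude given by the law of
  cosines is at distance at most \<open>d\<close>, so the root in \<open>tri\<close> is
  real.\<close>

lemma tri_height_nonneg:
  fixes n d r :: real
  assumes "n > 0" "\<bar>n - r\<bar> \<le> d" "d \<le> n + r"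
  shows "((d\<^sup>2 + n\<^sup>2 - r\<^sup>2) / (2 * n))\<^sup>2 \<le> d\<^sup>2"
proof -
  have "d \<ge> 0" using assms by linarith
  have "(n - d)\<^sup>2 \<le> r\<^sup>2"
    using assms by (intro abs_le_square_iff[THEN iffD1]) auto
  moreover have "r\<^sup>2 \<le> (n + d)\<^sup>2"
    using assms by (intro abs_le_square_iff[THEN iffD1]) auto
  ultimately have "\<bar>d\<^sup>2 + n\<^sup>2 - r\<^sup>2\<bar> \<le> 2 * n * d"
    by (simp add: power2_eq_square algebra_simps abs_le_iff)
  then have "\<bar>(d\<^sup>2 + n\<^sup>2 - r\<^sup>2) / (2 * n)\<bar> \<le> \<bar>d\<bar>"
    using assms(1) \<open>d \<ge> 0\<close> by (simp add: field_simps abs_mult)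
  then show ?thesis
    by (simp only: abs_le_square_iff)
qed

lemma
  assumes "z \<noteq> 0" "\<bar>cmod z - r\<bar> \<le> d" "d \<le> cmod z + r" "r \<ge> 0" "s * s = 1"
  shows cmod_tri: "cmod (tri z d r s) = d"
    and cmod_tri_diff: "cmod (tri z d r s - z) = r"
proof -
  define n where "n = cmod z"
  define A where "A = (d\<^sup>2 + n\<^sup>2 - r\<^sup>2) / (2 * n)"
  define B where "B = s * sqrt (d\<^sup>2 - A\<^sup>2)"
  have n: "n > 0" using assms(1) by (simp add: n_def)
  have AB: "A\<^sup>2 \<le> d\<^sup>2"
    using tri_height_nonneg[of n r d] assms n by (simp add: A_def n_def)
  have B2: "B\<^sup>2 = d\<^sup>2 - A\<^sup>2"
    using AB assms(5) by (simp add: B_def power_mult_distrib power2_eq_square[of s])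
  have sg: "cmod (sgn z) = 1" using assms(1) by (simp add: norm_sgn)
  have t: "tri z d r s = sgn z * Complex A B"
    by (simp add: tri_def A_def B_def n_def complex_eq_iff)
  have d: "d \<ge> 0" using assms(2) by linarith
  have "(cmod (tri z d r s))\<^sup>2 = d\<^sup>2"
    by (simp add: t norm_mult sg cmod_sq B2)
  then show "cmod (tri z d r s) = d"
    using d by (simp add: power2_eq_iff_nonneg)
  have z: "z = sgn z * of_real n"
    using assms(1) by (simp add: n_def sgn_eq)
  have "tri z d r s - z = sgn z * (Complex A B - of_real n)"
    by (subst (2) z) (simp add: t algebra_simps)
  then have "(cmod (tri z d r s - z))\<^sup>2 = (A - n)\<^sup>2 + B\<^sup>2"
    by (simp add: norm_mult sg cmod_sq)
  also have "\<dots> = n\<^sup>2 - 2 * n * A + d\<^sup>2"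
    by (simp add: B2 power2_diff)
  also have "\<dots> = r\<^sup>2"
    using n by (simp add: A_def)
  finally show "cmod (tri z d r s - z) = r"
    using assms(4) by (simp add: power2_eq_iff_nonneg)
qed

text \<open>In the frame whose real axis points along \<open>z\<close>, the two distances fix the
  real part of \<open>w\<close> and the modulus of its imaginary part. For a flat triangle both
  signs satisfy the last hypothesis.\<close>

lemma tri_unique:
  assumes "z \<noteq> 0" "cmod w = d" "cmod (w - z) = r" "s * s = 1" "s * Im (cnj z * w) \<ge> 0"
  shows "tri z d r s = w"
proof -
  define n where "n = cmod z"
  define q where "q = cnj (sgn z) * w"
  have n: "n > 0" using assms(1) by (simp add: n_def)
  have sg: "sgn z * cnj (sgn z) = 1"
    using assms(1) by (simp add: complex_norm_square[symmetric] norm_sgn)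
  have w: "w = sgn z * q"
    by (simp add: q_def mult.assoc[symmetric] sg)
  have cq: "cmod q = d"
    using assms(1,2) by (simp add: q_def norm_mult norm_sgn)
  have z: "z = sgn z * of_real n"
    using assms(1) by (simp add: n_def sgn_eq)
  have "w - z = sgn z * (q - of_real n)"
    by (subst w, subst (2) z) (simp add: algebra_simps)
  then have "cmod (q - of_real n) = r"
    using assms(1,3) by (simp add: norm_mult norm_sgn)
  then have "(Re q - n)\<^sup>2 + (Im q)\<^sup>2 = r\<^sup>2"
    using cmod_sq[of "q - of_real n"] by simp
  moreover have d2: "(Re q)\<^sup>2 + (Im q)\<^sup>2 = d\<^sup>2"
    using cmod_sq[of q] cq by simp
  ultimately have "2 * n * Re q = d\<^sup>2 + n\<^sup>2 - r\<^sup>2"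
    by (simp add: power2_diff algebra_simps)
  then have A: "(d\<^sup>2 + n\<^sup>2 - r\<^sup>2) / (2 * n) = Re q"
    using n by (simp add: field_simps)
  have "cnj z * w = of_real n * q"
    using sg by (subst z, subst w) (simp add: algebra_simps)
  then have "s * Im q \<ge> 0"
    using assms(5) n by (simp add: zero_le_mult_iff mult.left_commute[of s])
  moreover have "sqrt (d\<^sup>2 - (Re q)\<^sup>2) = \<bar>Im q\<bar>"
    using d2 by (simp add: eq_diff_eq[symmetric] flip: d2)
  moreover have "s = 1 \<or> s = -1"
    using assms(4) by (simp add: square_eq_1_iff)
  ultimately have "s * sqrt (d\<^sup>2 - (Re q)\<^sup>2) = Im q"
    by auto
  then show ?thesis
    unfolding tri_def n_def[symmetric] A w
    by (simp add: complex_eq_iff)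
qed

lemma continuous_on_tri [continuous_intros]:
  fixes z :: "'a::topological_space \<Rightarrow> complex"
  assumes "continuous_on S z" "continuous_on S d" "\<And>t. t \<in> S \<Longrightarrow> z t \<noteq> 0"
  shows "continuous_on S (\<lambda>t. tri (z t) (d t) r s)"
  unfolding tri_def sgn_div_norm
  by (intro continuous_intros assms) (use assms(3) in auto)

text \<open>A flat triangle has height 0, and the sign enters \<open>tri\<close> only as a factor of
  the height.\<close>

lemma tri_degenerate:
  assumes "z \<noteq> 0" "d = cmod z + r \<or> cmod z = d + r \<or> r = d + cmod z"
  shows "tri z d r s = tri z d r s'"
proof -
  have "((d\<^sup>2 + (cmod z)\<^sup>2 - r\<^sup>2) / (2 * cmod z))\<^sup>2 = d\<^sup>2"
    using assms by (auto simp: field_simps power2_eq_square)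
  then show ?thesis by (simp add: tri_def)
qed

text \<open>Two non-parallel edges can absorb any small displacement of their sum.\<close>
lemma parallelogram_move:
  fixes y :: "real \<Rightarrow> complex"
  assumes ab: "a < b" and y: "continuous_on {a..b} y" "y a = p + q"
    and pq: "Im (cnj p * q) \<noteq> 0"
  obtains c A where "a < c" "c \<le> b" "continuous_on {a..c} A" "A a = p"
    "\<And>t. t \<in> {a..c} \<Longrightarrow> cmod (A t) = cmod p" "\<And>t. t \<in> {a..c} \<Longrightarrow> cmod (y t - A t) = cmod q"
proof -
  \<comment> \<open>The side on which \<open>p\<close> lies of the diagonal \<open>p + q\<close>;
    the triangle has to keep it in order to start at \<open>p\<close>.\<close>
  define s :: real where "s = sgn (Im (cnj (p + q) * p))"
  have im: "Im (cnj (p + q) * p) = - Im (cnj p * q)"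
    by (simp add: algebra_simps)
  have s: "s * s = 1" using pq unfolding s_def im by (simp add: sgn_if)
  have sp: "s * Im (cnj (p + q) * p) \<ge> 0" unfolding s_def by (simp add: sgn_if)
  have pq0: "p + q \<noteq> 0"
  proof
    assume "p + q = 0"
    then have "Im (cnj (p + q) * p) = 0"
      by (simp only: complex_cnj_zero mult_zero_left zero_complex.sel)
    then show False using pq im by simp
  qed
  have cs: "(cmod (p + q))\<^sup>2 = (cmod p)\<^sup>2 + (cmod q)\<^sup>2 + 2 * Re (cnj p * q)"
    unfolding cmod_sq by (simp add: power2_eq_square algebra_simps)
  have "(Re (cnj p * q))\<^sup>2 < (cmod (cnj p * q))\<^sup>2"
    unfolding cmod_sq using pq by simp
  then have R: "\<bar>Re (cnj p * q)\<bar> < cmod p * cmod q"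
    using power2_less_imp_less[of "\<bar>Re (cnj p * q)\<bar>" "cmod (cnj p * q)"]
    by (simp add: norm_mult)
  \<comment> \<open>Both triangle inequalities are strict because \<open>p\<close> and
    \<open>q\<close> are not parallel; hence they persist along \<open>y\<close> for a short
    time.\<close>
  have 1: "cmod (p + q) < cmod p + cmod q"
    by (rule power2_less_imp_less) (use R in \<open>auto simp: cs power2_sum\<close>)
  have "(cmod p - cmod q)\<^sup>2 < (cmod (p + q))\<^sup>2"
    using R by (auto simp: cs power2_diff)
  then have 2: "\<bar>cmod p - cmod q\<bar> < cmod (p + q)"
    using power2_less_imp_less[of "\<bar>cmod p - cmod q\<bar>" "cmod (p + q)"] by simp
  have "\<forall>\<^sub>F t in at a within {a..b}. cmod (y t) < cmod p + cmod q \<and> \<bar>cmod p - cmod q\<bar> < cmod (y t)"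
  proof (intro eventually_conj)
    have "(y \<longlongrightarrow> p + q) (at a within {a..b})"
      using y(1)[unfolded continuous_on_def, THEN bspec, of a] y(2) ab by simp
    then have "((\<lambda>t. cmod (y t)) \<longlongrightarrow> cmod (p + q)) (at a within {a..b})"
      by (rule tendsto_norm)
    then show "\<forall>\<^sub>F t in at a within {a..b}. cmod (y t) < cmod p + cmod q"
      "\<forall>\<^sub>F t in at a within {a..b}. \<bar>cmod p - cmod q\<bar> < cmod (y t)"
      using 1 2 by (auto dest: order_tendstoD)
  qed
  then obtain e where e: "e > 0" "\<And>t. t \<in> {a..b} \<Longrightarrow> t \<noteq> a \<Longrightarrow> dist t a < e \<Longrightarrow>
     cmod (y t) < cmod p + cmod q \<and> \<bar>cmod p - cmod q\<bar> < cmod (y t)"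
    unfolding eventually_at by auto
  define c where "c = min b (a + e / 2)"
  have c: "a < c" "c \<le> b" using ab e(1) by (auto simp: c_def)
  have in_ann: "cmod (y t) < cmod p + cmod q \<and> \<bar>cmod p - cmod q\<bar> < cmod (y t)" if "t \<in> {a..c}" for t
  proof (cases "t = a")
    case True then show ?thesis using 1 2 y by simp
  next
    case False
    then show ?thesis using that e(1) by (intro e(2)) (auto simp: c_def dist_real_def)
  qed
  have y0: "y t \<noteq> 0" if "t \<in> {a..c}" for t
    using in_ann[OF that] by auto
  show thesis
  proof
    show "continuous_on {a..c} (\<lambda>t. tri (y t) (cmod p) (cmod q) s)"
      by (intro continuous_intros continuous_on_subset[OF y(1)] y0) (use c in auto)
    show "tri (y a) (cmod p) (cmod q) s = p"
      by (rule tri_unique) (use y(2) pq0 s sp in auto)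
    show "cmod (tri (y t) (cmod p) (cmod q) s) = cmod p" if "t \<in> {a..c}" for t
      by (rule cmod_tri) (use s y0[OF that] in_ann[OF that] in auto)
    show "cmod (y t - tri (y t) (cmod p) (cmod q) s) = cmod q" if "t \<in> {a..c}" for t
      unfolding norm_minus_commute[of "y t"]
      by (rule cmod_tri_diff) (use s y0[OF that] in_ann[OF that] in auto)
  qed (use c in auto)
qed

section \<open>Diagonal lengths\<close>

text \<open>The start vertex is the origin and carries no index: \<open>Z j\<close> is the end of
  edge \<open>j\<close>, and \<open>Z 0\<close> is a dummy.\<close>

definition steps :: "(nat \<Rightarrow> complex) \<Rightarrow> nat \<Rightarrow> complex" where
  "steps Z i = (if i = 1 then Z 1 else Z i - Z (i - 1))"

lemma sum_steps: "j \<ge> 1 \<Longrightarrow> (\<Sum>i\<in>{1..j}. steps Z i) = Z j"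
  by (induction j rule: dec_induct) (simp_all add: steps_def)

locale linkage =
  fixes k :: nat and l :: "nat \<Rightarrow> real"
  assumes k_ge_2: "k \<ge> 2"
    and l_pos: "i \<in> {1..k} \<Longrightarrow> l i > 0"
    and l_2_le_1: "l 2 \<le> l 1"
    and l_le_2: "i \<in> {3..k} \<Longrightarrow> l i \<le> l 2"
begin

definition admissible :: "(nat \<Rightarrow> real) \<Rightarrow> bool" where
  "admissible d \<longleftrightarrow> d 1 = l 1 \<and>
     (\<forall>j\<in>{1..<k}. \<bar>d j - l (Suc j)\<bar> \<le> d (Suc j) \<and> d (Suc j) \<le> d j + l (Suc j))"

text \<open>The last diagonal is left out: no triangle is built on it, and a path of values may pass
  through 0.\<close>

definition positive :: "(nat \<Rightarrow> real) \<Rightarrow> bool" where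
  "positive d \<longleftrightarrow> (\<forall>j\<in>{1..<k}. d j > 0)"

definition slack :: real where
  "slack = (\<Sum>i\<in>{2..k}. l i)"

text \<open>The interval of last diagonals of admissible sequences:
  \<open>admissible_feasible\<close> is one inclusion, \<open>ex_folded\<close> the other.\<close>

definition feasible :: "real \<Rightarrow> bool" where
  "feasible x \<longleftrightarrow> 0 \<le> x \<and> \<bar>x - l 1\<bar> \<le> slack"

lemma l_Suc_pos: "j < k \<Longrightarrow> l (Suc j) > 0"
  by (rule l_pos) auto

lemma slack_nonneg: "slack \<ge> 0"
  unfolding slack_def by (intro sum_nonneg) (use l_pos in \<open>auto intro!: less_imp_le\<close>)

lemma l1_pos: "l 1 > 0"
  using k_ge_2 by (auto intro!: l_pos)

text \<open>An upper bound on an absolute value is a pair of linear inequalities, so every triangle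
  condition is convex.\<close>

lemma admissible_convex:
  assumes "admissible d" "admissible e" "0 \<le> s" "s \<le> 1"
  shows "admissible (\<lambda>j. (1 - s) * d j + s * e j)"
proof -
  have mix: "(1 - s) * a + s * b \<le> (1 - s) * a' + s * b'" if "a \<le> a'" "b \<le> b'" for a b a' b'
    using that assms by (intro add_mono mult_left_mono) auto
  have "\<bar>((1 - s) * d j + s * e j) - l (Suc j)\<bar> \<le> (1 - s) * d (Suc j) + s * e (Suc j) \<and>
       (1 - s) * d (Suc j) + s * e (Suc j) \<le> ((1 - s) * d j + s * e j) + l (Suc j)"
    if j: "j \<in> {1..<k}" for j
  proof -
    have A: "\<bar>d j - l (Suc j)\<bar> \<le> d (Suc j)" "d (Suc j) \<le> d j + l (Suc j)"
        "\<bar>e j - l (Suc j)\<bar> \<le> e (Suc j)" "e (Suc j) \<le> e j + l (Suc j)"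
      using assms(1,2) j by (auto simp: admissible_def)
    show ?thesis
      using mix[of "d j - l (Suc j)" "d (Suc j)" "e j - l (Suc j)" "e (Suc j)"]
        mix[of "l (Suc j) - d j" "d (Suc j)" "l (Suc j) - e j" "e (Suc j)"]
        mix[of "d (Suc j)" "d j + l (Suc j)" "e (Suc j)" "e j + l (Suc j)"] A
      by (simp add: abs_le_iff algebra_simps)
  qed
  then show ?thesis
    using assms(1,2) by (simp add: admissible_def algebra_simps)
qed

lemma admissible_nonneg: "admissible d \<Longrightarrow> j \<in> {1..k} \<Longrightarrow> d j \<ge> 0"
proof -
  assume d: "admissible d" and j: "j \<in> {1..k}"
  show "d j \<ge> 0"
  proof (cases "j = 1")
    case True then show ?thesis using d l1_pos by (simp add: admissible_def)
  next
    case False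
    then have "j - 1 \<in> {1..<k}" "Suc (j - 1) = j" using j by auto
    then have "\<bar>d (j - 1) - l j\<bar> \<le> d j"
      using d unfolding admissible_def by metis
    then show ?thesis by linarith
  qed
qed

lemma admissible_feasible:
  assumes "admissible d" shows "feasible (d k)"
proof -
  have "\<bar>d j - l 1\<bar> \<le> (\<Sum>i\<in>{2..j}. l i)" if "1 \<le> j" "j \<le> k" for j
    using that
  proof (induction j rule: dec_induct)
    case base
    then show ?case using assms by (simp add: admissible_def)
  next
    case (step n)
    have "\<bar>d n - l (Suc n)\<bar> \<le> d (Suc n)" "d (Suc n) \<le> d n + l (Suc n)"
      using assms step by (auto simp: admissible_def)
    moreover have "(\<Sum>i\<in>{2..Suc n}. l i) = (\<Sum>i\<in>{2..n}. l i) + l (Suc n)"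
      using step by (simp add: sum.atLeast_Suc_atMost)
    ultimately show ?case using step by (simp add: abs_le_iff)
  qed
  then show ?thesis
    using admissible_nonneg[OF assms, of k] k_ge_2 by (simp add: feasible_def slack_def)
qed

text \<open>Going down from the last diagonal, each edge is folded towards length \<open>l 1\<close>; since no edge
  is longer than \<open>l 2\<close>, this ends in a triangle with sides \<open>l 1\<close> and \<open>l 2\<close>.\<close>
lemma ex_folded:
  assumes "feasible x"
  shows "\<exists>d. admissible d \<and> positive d \<and> d k = x \<and>
    (\<forall>j\<in>{2..<k}. d j = d (Suc j) + l (Suc j) \<or> d (Suc j) = d j + l (Suc j))"
proof -
  have "\<exists>d. d 1 = l 1 \<and> d n = x \<and>
     (\<forall>j\<in>{1..<n}. \<bar>d j - l (Suc j)\<bar> \<le> d (Suc j) \<and> d (Suc j) \<le> d j + l (Suc j) \<and> d j > 0) \<and>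
     (\<forall>j\<in>{2..<n}. d j = d (Suc j) + l (Suc j) \<or> d (Suc j) = d j + l (Suc j))"
    if "2 \<le> n" "n \<le> k" "0 \<le> x" "\<bar>x - l 1\<bar> \<le> (\<Sum>i\<in>{2..n}. l i)" for n x
    using that
  proof (induction n arbitrary: x rule: dec_induct)
    case base
    have "{1..<2::nat} = {1}" by auto
    then show ?case using base l_2_le_1 l1_pos
      by (intro exI[of _ "\<lambda>j. if j = 1 then l 1 else x"]) (auto simp: numeral_2_eq_2)
  next
    case (step n)
    \<comment> \<open>Either the distance to \<open>l 1\<close> drops by \<open>l (Suc n)\<close>,
      or \<open>l 1\<close> is passed and the new distance is at most
      \<open>l (Suc n) \<le> l 2\<close>, which the remaining edges cover. A subtraction happens
      only above \<open>l 1\<close>, so \<open>y\<close> stays positive.\<close>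
    define y where "y = (if x \<le> l 1 then x + l (Suc n) else x - l (Suc n))"
    have ln: "0 < l (Suc n)" "l (Suc n) \<le> l 2"
      using step l_Suc_pos[of n] l_le_2[of "Suc n"] by auto
    have s: "(\<Sum>i\<in>{2..Suc n}. l i) = (\<Sum>i\<in>{2..n}. l i) + l (Suc n)"
      using step by simp
    have "l 2 \<le> (\<Sum>i\<in>{2..n}. l i)"
      using step.hyps step.prems
      by (intro member_le_sum) (auto intro!: less_imp_le l_pos)
    then have y: "y > 0" "\<bar>y - l 1\<bar> \<le> (\<Sum>i\<in>{2..n}. l i)"
      using step.prems ln l_2_le_1 unfolding s y_def by (auto simp: abs_le_iff)
    obtain d where d: "d 1 = l 1" "d n = y"
     "\<forall>j\<in>{1..<n}. \<bar>d j - l (Suc j)\<bar> \<le> d (Suc j) \<and> d (Suc j) \<le> d j + l (Suc j) \<and> d j > 0"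
     "\<forall>j\<in>{2..<n}. d j = d (Suc j) + l (Suc j) \<or> d (Suc j) = d j + l (Suc j)"
      using step.IH[of y] y step.prems by auto
    have yx: "\<bar>y - l (Suc n)\<bar> \<le> x" "x \<le> y + l (Suc n)" "y = x + l (Suc n) \<or> x = y + l (Suc n)"
      using step.prems ln l_2_le_1 by (auto simp: y_def)
    have 1: "{1..<Suc n} = insert n {1..<n}" "{2..<Suc n} = insert n {2..<n}"
      using step.hyps by auto
    show ?case
      using d yx y step.hyps unfolding 1
      by (intro exI[of _ "d(Suc n := x)"]) auto
  qed
  from this[of k x] show ?thesis
    using assms k_ge_2 by (auto simp: feasible_def slack_def admissible_def positive_def)
qed

definition folded :: "real \<Rightarrow> nat \<Rightarrow> real" where
  "folded x = (SOME d. admissible d \<and> positive d \<and> d k = x \<and>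
    (\<forall>j\<in>{2..<k}. d j = d (Suc j) + l (Suc j) \<or> d (Suc j) = d j + l (Suc j)))"

lemma folded:
  assumes "feasible x"
  shows "admissible (folded x)" "positive (folded x)" "folded x k = x"
    "j \<in> {2..<k} \<Longrightarrow> folded x j = folded x (Suc j) + l (Suc j) \<or>
       folded x (Suc j) = folded x j + l (Suc j)"
  using someI_ex[OF ex_folded[OF assms]] by (auto simp: folded_def)

section \<open>Continuous choice of diagonals over a given last diagonal\<close>

definition xmin :: real where "xmin = max 0 (l 1 - slack)"
definition xmax :: real where "xmax = l 1 + slack"

lemma feasible_iff: "feasible x \<longleftrightarrow> xmin \<le> x \<and> x \<le> xmax"
  by (auto simp: feasible_def xmin_def xmax_def abs_le_iff)

lemma feasible_xmin: "feasible xmin" and feasible_xmax: "feasible xmax"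
  using slack_nonneg l1_pos by (auto simp: feasible_def xmin_def xmax_def)

text \<open>A piecewise linear right inverse of the map from \<open>d\<close> to \<open>d k\<close>
  that passes through \<open>g\<close>: it runs towards \<open>folded xmax\<close> above
  \<open>g k\<close> and towards \<open>folded xmin\<close> below. If \<open>g k\<close> is an end
  of the interval, the quotient with denominator zero is 0, as it should be.\<close>

definition section_through :: "(nat \<Rightarrow> real) \<Rightarrow> real \<Rightarrow> nat \<Rightarrow> real" where
  "section_through g x j = g j
     + max 0 (x - g k) / (xmax - g k) * (folded xmax j - g j)
     + max 0 (g k - x) / (g k - xmin) * (folded xmin j - g j)"

lemma section_through_self: "section_through g (g k) = g"
  by (simp add: section_through_def fun_eq_iff)

lemma continuous_on_section_through [continuous_intros]:
  "continuous_on S f \<Longrightarrow> continuous_on S (\<lambda>t. section_through g (f t) j)"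
  unfolding section_through_def divide_inverse by (intro continuous_intros)

lemma section_through_cases:
  assumes "admissible g" "feasible x"
  obtains s h where "section_through g x = (\<lambda>j. (1 - s) * g j + s * h j)"
    "0 \<le> s" "s \<le> 1" "admissible h" "positive h" "(1 - s) * g k + s * h k = x"
proof -
  note b = admissible_feasible[OF assms(1), unfolded feasible_iff] assms(2)[unfolded feasible_iff]
  show thesis
  proof (cases "x \<ge> g k")
    case True
    define s where "s = (x - g k) / (xmax - g k)"
    show thesis
    proof
      show "section_through g x = (\<lambda>j. (1 - s) * g j + s * folded xmax j)"
        using True by (simp add: section_through_def s_def[symmetric] fun_eq_iff algebra_simps)
      have "s * (xmax - g k) = x - g k"
        using True b by (auto simp: s_def)
      then show "(1 - s) * g k + s * folded xmax k = x"
        by (simp add: folded feasible_xmax algebra_simps)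
    qed (use True b in \<open>auto simp: s_def folded feasible_xmax divide_le_eq_1\<close>)
  next
    case False
    define s where "s = (g k - x) / (g k - xmin)"
    show thesis
    proof
      show "section_through g x = (\<lambda>j. (1 - s) * g j + s * folded xmin j)"
        using False by (simp add: section_through_def s_def[symmetric] fun_eq_iff algebra_simps)
      have "s * (g k - xmin) = g k - x"
        using False b by (auto simp: s_def)
      then show "(1 - s) * g k + s * folded xmin k = x"
        by (simp add: folded feasible_xmin algebra_simps)
    qed (use False b in \<open>auto simp: s_def folded feasible_xmin divide_le_eq_1\<close>)
  qed
qed

lemma convex_pos:
  fixes a b s :: real
  shows "a > 0 \<Longrightarrow> b > 0 \<Longrightarrow> 0 \<le> s \<Longrightarrow> s \<le> 1 \<Longrightarrow> (1 - s) * a + s * b > 0"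
  by (cases "s = 0") (auto intro!: add_nonneg_pos)

text \<open>Positivity is inherited index by index, so that it can also be used for a
  \<open>g\<close> with \<open>g 2 = 0\<close>.\<close>

lemma
  assumes "admissible g" "feasible x"
  shows section_through_admissible: "admissible (section_through g x)"
    and section_through_last: "section_through g x k = x"
    and section_through_pos: "j \<in> {1..<k} \<Longrightarrow> g j > 0 \<Longrightarrow> section_through g x j > 0"
proof -
  obtain s h where s: "section_through g x = (\<lambda>j. (1 - s) * g j + s * h j)"
    "0 \<le> s" "s \<le> 1" "admissible h" "positive h" "(1 - s) * g k + s * h k = x"
    using section_through_cases[OF assms] .
  show "admissible (section_through g x)" unfolding s(1)
    using s assms by (intro admissible_convex)
  show "section_through g x k = x" using s by simp
  show "j \<in> {1..<k} \<Longrightarrow> g j > 0 \<Longrightarrow> section_through g x j > 0"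
    unfolding s(1) using s by (intro convex_pos) (auto simp: positive_def)
qed

text \<open>The sections through \<open>d\<close> and through \<open>e\<close> both lie over
  \<alpha>, hence so do their convex combinations; the weight moves from 0 to 1 with time.\<close>

lemma admissible_path:
  fixes a b :: real
  assumes ab: "a < b" and \<alpha>: "continuous_on {a..b} \<alpha>" "\<And>t. t \<in> {a..b} \<Longrightarrow> feasible (\<alpha> t)"
    and d: "admissible d" "positive d" "d k = \<alpha> a" and e: "admissible e" "positive e" "e k = \<alpha> b"
  obtains D where "\<And>j. continuous_on {a..b} (\<lambda>t. D t j)" "D a = d" "D b = e"
    "\<And>t. t \<in> {a..b} \<Longrightarrow> admissible (D t) \<and> positive (D t) \<and> D t k = \<alpha> t"
proof
  define s where "s t = (t - a) / (b - a)" for t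
  define D where "D t j = (1 - s t) * section_through d (\<alpha> t) j + s t * section_through e (\<alpha> t) j" for t j
  show "continuous_on {a..b} (\<lambda>t. D t j)" for j
    unfolding D_def s_def using ab by (intro continuous_intros \<alpha>(1)) auto
  show "D a = d" "D b = e"
    using ab d(3) e(3) section_through_self[of d] section_through_self[of e]
    by (simp_all add: D_def s_def fun_eq_iff)
  fix t assume t: "t \<in> {a..b}"
  have s: "0 \<le> s t" "s t \<le> 1" using t ab by (auto simp: s_def)
  have "admissible (D t)"
    unfolding D_def using s t d e \<alpha>(2)
    by (intro admissible_convex section_through_admissible) auto
  moreover have "positive (D t)"
    unfolding positive_def D_def using s t d e \<alpha>(2)
    by (intro ballI convex_pos section_through_pos) (auto simp: positive_def)
  moreover have "D t k = \<alpha> t"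
    using t d e \<alpha>(2) by (simp add: D_def section_through_last algebra_simps)
  ultimately show "admissible (D t) \<and> positive (D t) \<and> D t k = \<alpha> t" by simp
qed


section \<open>Configurations from diagonals and orientations\<close>

text \<open>The construction starts at index \<open>n\<close>; smaller indices carry a dummy value.
  Starting later than 1 serves to get past a vanishing second diagonal. The sign \<open>e j\<close>
  orients the triangle with sides \<open>d (j - 1)\<close>, \<open>l j\<close>, \<open>d j\<close>,
  so the first triangle belongs to \<open>e 2\<close>.\<close>

primrec chain :: "nat \<Rightarrow> complex \<Rightarrow> (nat \<Rightarrow> real) \<Rightarrow> (nat \<Rightarrow> real) \<Rightarrow> nat \<Rightarrow> complex" where
  "chain n z d e 0 = z"
| "chain n z d e (Suc j) =
     (if Suc j \<le> n then z else tri (chain n z d e j) (d (Suc j)) (l (Suc j)) (e (Suc j)))"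

definition signs :: "(nat \<Rightarrow> real) \<Rightarrow> bool" where
  "signs e \<longleftrightarrow> (\<forall>j. e j * e j = 1)"

lemma chain_start [simp]: "chain n z d e n = z"
  by (cases n) auto

lemma
  assumes n: "1 \<le> n" and d: "admissible d" "\<And>j. j \<in> {n..<k} \<Longrightarrow> d j > 0"
    and e: "signs e" and z: "cmod z = d n"
  shows cmod_chain: "j \<in> {n..k} \<Longrightarrow> cmod (chain n z d e j) = d j"
    and cmod_chain_diff: "j \<in> {n..<k} \<Longrightarrow> cmod (chain n z d e (Suc j) - chain n z d e j) = l (Suc j)"
proof -
  have next_diag: "cmod (chain n z d e (Suc j)) = d (Suc j) \<and>
      cmod (chain n z d e (Suc j) - chain n z d e j) = l (Suc j)"
    if "j \<in> {n..<k}" "cmod (chain n z d e j) = d j" for j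
  proof -
    have "chain n z d e j \<noteq> 0" using d(2)[OF that(1)] that(2) by auto
    moreover have "\<bar>d j - l (Suc j)\<bar> \<le> d (Suc j)" "d (Suc j) \<le> d j + l (Suc j)" "l (Suc j) > 0"
      using d(1) that n l_Suc_pos[of j] by (auto simp: admissible_def)
    ultimately show ?thesis
      using that e by (auto simp: signs_def intro!: cmod_tri cmod_tri_diff)
  qed
  have N: "cmod (chain n z d e j) = d j" if "n \<le> j" "j \<le> k" for j
    using that
  proof (induction j rule: dec_induct)
    case base then show ?case using z by simp
  next
    case (step j) then show ?case using next_diag[of j] by simp
  qed
  show "j \<in> {n..k} \<Longrightarrow> cmod (chain n z d e j) = d j" using N by simp
  show "j \<in> {n..<k} \<Longrightarrow> cmod (chain n z d e (Suc j) - chain n z d e j) = l (Suc j)"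
    using next_diag[of j] N[of j] by auto
qed

lemma continuous_on_chain:
  fixes S :: "real set"
  assumes n: "1 \<le> n" and d: "\<And>t. t \<in> S \<Longrightarrow> admissible (d t)" "\<And>t j. t \<in> S \<Longrightarrow> j \<in> {n..<k} \<Longrightarrow> d t j > 0"
    and e: "signs e" and z: "\<And>t. t \<in> S \<Longrightarrow> cmod (z t) = d t n"
    and c: "continuous_on S z" "\<And>j. continuous_on S (\<lambda>t. d t j)"
    and j: "n \<le> j" "j \<le> k"
  shows "continuous_on S (\<lambda>t. chain n (z t) (d t) e j)"
  using j
proof (induction j rule: dec_induct)
  case base then show ?case using c by simp
next
  case (step j)
  have "chain n (z t) (d t) e j \<noteq> 0" if "t \<in> S" for t
    using cmod_chain[OF n d(1)[OF that] d(2)[OF that] e z[OF that], of j] d(2)[OF that, of j] step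
    by auto
  then show ?case
    using step by (simp add: continuous_on_tri c)
qed

lemma chain_restart:
  assumes "chain n z d e m = w" "n \<le> m" "m \<le> j"
  shows "chain m w d e j = chain n z d e j"
  using assms(3)
proof (induction j rule: dec_induct)
  case base then show ?case using assms by simp
next
  case (step j) then show ?case using assms(2) by simp
qed

text \<open>Normal form modulo rotation, with the first edge on the positive real axis.\<close>

definition config :: "(nat \<Rightarrow> real) \<Rightarrow> (nat \<Rightarrow> real) \<Rightarrow> nat \<Rightarrow> complex" where
  "config d e = steps (chain 1 (of_real (l 1)) d e)"

lemma cmod_steps:
  assumes "cmod (Z 1) = l 1" "\<And>j. j \<in> {1..<k} \<Longrightarrow> cmod (Z (Suc j) - Z j) = l (Suc j)" "i \<in> {1..k}"
  shows "cmod (steps Z i) = l i"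
proof (cases "i = 1")
  case False
  then have "i - 1 \<in> {1..<k}" "Suc (i - 1) = i" using assms(3) by auto
  then show ?thesis using False assms(2)[of "i - 1"] by (simp add: steps_def)
qed (use assms in \<open>simp add: steps_def\<close>)

lemma steps_cong:
  assumes "\<And>i. i \<in> {1..k} \<Longrightarrow> Z i = W i" "i \<in> {1..k}"
  shows "steps Z i = steps W i"
proof (cases "i = 1")
  case False
  then have "i - 1 \<in> {1..k}" using assms(2) by auto
  then show ?thesis using False assms(1)[OF assms(2)] assms(1)[of "i - 1"] by (simp add: steps_def)
qed (use assms in \<open>auto simp: steps_def\<close>)

lemma continuous_on_steps:
  assumes "\<And>j. j \<in> {1..k} \<Longrightarrow> continuous_on S (\<lambda>t. Z t j)" "i \<in> {1..k}"
  shows "continuous_on S (\<lambda>t. steps (Z t) i)"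
proof (cases "i = 1")
  case False
  then have "i - 1 \<in> {1..k}" using assms(2) by auto
  then show ?thesis
    using False assms(1)[OF assms(2)] assms(1)[of "i - 1"]
    by (auto simp: steps_def intro!: continuous_on_diff)
qed (use assms in \<open>auto simp: steps_def\<close>)

section \<open>Paths of edge vectors over a path of values\<close>

text \<open>Endpoints are prescribed only up to rotation, since only their classes matter.\<close>
definition lifts :: "(real \<Rightarrow> real) \<Rightarrow> real \<Rightarrow> real \<Rightarrow> (nat \<Rightarrow> complex) \<Rightarrow> (nat \<Rightarrow> complex) \<Rightarrow> bool" where
  "lifts \<alpha> a b u v \<longleftrightarrow> (\<exists>\<beta>.
     (\<forall>i\<in>{1..k}. continuous_on {a..b} (\<lambda>t. \<beta> t i)) \<and>
     (\<forall>t\<in>{a..b}. (\<forall>i\<in>{1..k}. cmod (\<beta> t i) = l i) \<and> cmod (\<Sum>i\<in>{1..k}. \<beta> t i) = \<alpha> t) \<and>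
     (\<exists>c. cmod c = 1 \<and> (\<forall>i\<in>{1..k}. \<beta> a i = c * u i)) \<and>
     (\<exists>c. cmod c = 1 \<and> (\<forall>i\<in>{1..k}. \<beta> b i = c * v i)))"

lemma liftsI:
  assumes "\<And>i. i \<in> {1..k} \<Longrightarrow> continuous_on {a..b} (\<lambda>t. \<beta> t i)"
    "\<And>t i. t \<in> {a..b} \<Longrightarrow> i \<in> {1..k} \<Longrightarrow> cmod (\<beta> t i) = l i"
    "\<And>t. t \<in> {a..b} \<Longrightarrow> cmod (\<Sum>i\<in>{1..k}. \<beta> t i) = \<alpha> t"
    "cmod c = 1" "\<And>i. i \<in> {1..k} \<Longrightarrow> \<beta> a i = c * u i"
    "cmod c' = 1" "\<And>i. i \<in> {1..k} \<Longrightarrow> \<beta> b i = c' * v i"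
  shows "lifts \<alpha> a b u v"
proof -
  have "\<exists>c. cmod c = 1 \<and> (\<forall>i\<in>{1..k}. \<beta> a i = c * u i)"
    "\<exists>c. cmod c = 1 \<and> (\<forall>i\<in>{1..k}. \<beta> b i = c * v i)"
    using assms(4-7) by blast+
  then show ?thesis
    unfolding lifts_def using assms(1-3) by (intro exI[of _ \<beta>] conjI ballI) auto
qed

lemma lifts_rotate:
  assumes "lifts \<alpha> a b u v" "cmod c = 1" "\<And>i. i \<in> {1..k} \<Longrightarrow> u i = c * u' i"
    "cmod c' = 1" "\<And>i. i \<in> {1..k} \<Longrightarrow> v i = c' * v' i"
  shows "lifts \<alpha> a b u' v'"
proof -
  obtain \<beta> r r' where \<beta>: "\<forall>i\<in>{1..k}. continuous_on {a..b} (\<lambda>t. \<beta> t i)"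
     "\<forall>t\<in>{a..b}. (\<forall>i\<in>{1..k}. cmod (\<beta> t i) = l i) \<and> cmod (\<Sum>i\<in>{1..k}. \<beta> t i) = \<alpha> t"
     "cmod r = 1" "\<forall>i\<in>{1..k}. \<beta> a i = r * u i" "cmod r' = 1" "\<forall>i\<in>{1..k}. \<beta> b i = r' * v i"
    using assms(1) unfolding lifts_def by blast
  show ?thesis
  proof (rule liftsI[of a b \<beta> \<alpha> "r * c" u' "r' * c'"])
    show "\<beta> a i = r * c * u' i" if "i \<in> {1..k}" for i
      using \<beta>(4) assms(3)[OF that] that by (simp add: mult.assoc)
    show "\<beta> b i = r' * c' * v' i" if "i \<in> {1..k}" for i
      using \<beta>(6) assms(5)[OF that] that by (simp add: mult.assoc)
    show "cmod (r * c) = 1" "cmod (r' * c') = 1"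
      using \<beta> assms(2,4) by (simp_all add: norm_mult)
  qed (use \<beta>(1,2) in auto)
qed

lemma lifts_refl:
  assumes "\<And>i. i \<in> {1..k} \<Longrightarrow> cmod (u i) = l i" "cmod (\<Sum>i\<in>{1..k}. u i) = \<alpha> a"
  shows "lifts \<alpha> a a u u"
  by (rule liftsI[of a a "\<lambda>t. u" \<alpha> 1 u 1]) (use assms in auto)

text \<open>The two paths meet only up to rotation. The second is turned as a whole by
  \<open>h\<close> to agree at time \<open>b\<close>, which changes neither lengths nor the modulus
  of the sum.\<close>

lemma lifts_trans:
  assumes "lifts \<alpha> a b u v" "lifts \<alpha> b c v w" "a \<le> b" "b \<le> c"
  shows "lifts \<alpha> a c u w"
proof -
  obtain \<beta> r r' where \<beta>: "\<And>i. i\<in>{1..k} \<Longrightarrow> continuous_on {a..b} (\<lambda>t. \<beta> t i)"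
     "\<forall>t\<in>{a..b}. (\<forall>i\<in>{1..k}. cmod (\<beta> t i) = l i) \<and> cmod (\<Sum>i\<in>{1..k}. \<beta> t i) = \<alpha> t"
     "cmod r = 1" "\<forall>i\<in>{1..k}. \<beta> a i = r * u i" "cmod r' = 1" "\<forall>i\<in>{1..k}. \<beta> b i = r' * v i"
    using assms(1) unfolding lifts_def by blast
  obtain \<gamma> q q' where \<gamma>: "\<And>i. i\<in>{1..k} \<Longrightarrow> continuous_on {b..c} (\<lambda>t. \<gamma> t i)"
     "\<forall>t\<in>{b..c}. (\<forall>i\<in>{1..k}. cmod (\<gamma> t i) = l i) \<and> cmod (\<Sum>i\<in>{1..k}. \<gamma> t i) = \<alpha> t"
     "cmod q = 1" "\<forall>i\<in>{1..k}. \<gamma> b i = q * v i" "cmod q' = 1" "\<forall>i\<in>{1..k}. \<gamma> c i = q' * w i"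
    using assms(2) unfolding lifts_def by blast
  define h where "h = r' / q"
  have h: "cmod h = 1" using \<beta> \<gamma> by (simp add: h_def norm_divide)
  have q0: "q \<noteq> 0" using \<gamma> by auto
  have join: "\<beta> b i = h * \<gamma> b i" if "i \<in> {1..k}" for i
    using \<beta>(6) \<gamma>(4) that q0 by (simp add: h_def)
  define \<delta> where "\<delta> t i = (if t \<le> b then \<beta> t i else h * \<gamma> t i)" for t i
  show ?thesis
  proof (rule liftsI[of a c \<delta> \<alpha> r u "h * q'"])
    fix i assume i: "i \<in> {1..k}"
    have "continuous_on ({a..b} \<union> {b..c}) (\<lambda>t. \<delta> t i)"
      unfolding \<delta>_def
      by (rule continuous_on_If)
        (use \<beta>(1)[OF i] \<gamma>(1)[OF i] join[OF i] in \<open>auto intro!: continuous_intros\<close>)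
    moreover have "{a..b} \<union> {b..c} = {a..c}" using assms by auto
    ultimately show "continuous_on {a..c} (\<lambda>t. \<delta> t i)" by simp
    show "\<delta> a i = r * u i" using \<beta>(4) i assms(3) by (simp add: \<delta>_def)
    show "\<delta> c i = h * q' * w i"
      using \<gamma>(6) i assms(4) join[OF i] by (auto simp: \<delta>_def)
  next
    fix t i assume "t \<in> {a..c}" "i \<in> {1..k}"
    then show "cmod (\<delta> t i) = l i" using \<beta>(2) \<gamma>(2) h by (auto simp: \<delta>_def norm_mult)
  next
    fix t assume t: "t \<in> {a..c}"
    have "(\<Sum>i\<in>{1..k}. \<delta> t i) = (if t \<le> b then (\<Sum>i\<in>{1..k}. \<beta> t i) else h * (\<Sum>i\<in>{1..k}. \<gamma> t i))"
      by (simp add: \<delta>_def sum_distrib_left)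
    then show "cmod (\<Sum>i\<in>{1..k}. \<delta> t i) = \<alpha> t"
      using t \<beta>(2) \<gamma>(2) h by (auto simp: norm_mult)
  qed (use \<beta> \<gamma> h in \<open>auto simp: norm_mult\<close>)
qed

text \<open>Carries constructions at time 0 over to time 1.\<close>

lemma lifts_reverse:
  assumes "lifts (\<lambda>t. \<alpha> (1 - t)) a b u v"
  shows "lifts \<alpha> (1 - b) (1 - a) v u"
proof -
  obtain \<beta> r r' where \<beta>: "\<And>i. i\<in>{1..k} \<Longrightarrow> continuous_on {a..b} (\<lambda>t. \<beta> t i)"
     "\<forall>t\<in>{a..b}. (\<forall>i\<in>{1..k}. cmod (\<beta> t i) = l i) \<and> cmod (\<Sum>i\<in>{1..k}. \<beta> t i) = \<alpha> (1 - t)"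
     "cmod r = 1" "\<forall>i\<in>{1..k}. \<beta> a i = r * u i" "cmod r' = 1" "\<forall>i\<in>{1..k}. \<beta> b i = r' * v i"
    using assms(1) unfolding lifts_def by blast
  show ?thesis
  proof (rule liftsI[of _ _ "\<lambda>t. \<beta> (1 - t)" _ r' _ r])
    fix i assume i: "i \<in> {1..k}"
    show "continuous_on {1 - b..1 - a} (\<lambda>t. \<beta> (1 - t) i)"
      by (rule continuous_on_compose2[OF \<beta>(1)[OF i]]) (auto intro!: continuous_intros)
  qed (use \<beta> in auto)
qed

lemma lifts_of_sums:
  assumes c: "\<And>j. j \<in> {1..k} \<Longrightarrow> continuous_on {a..b} (\<lambda>t. Z t j)"
    and 1: "\<And>t. t \<in> {a..b} \<Longrightarrow> cmod (Z t 1) = l 1"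
    and d: "\<And>t j. t \<in> {a..b} \<Longrightarrow> j \<in> {1..<k} \<Longrightarrow> cmod (Z t (Suc j) - Z t j) = l (Suc j)"
    and k: "\<And>t. t \<in> {a..b} \<Longrightarrow> cmod (Z t k) = \<alpha> t"
    and u: "\<And>i. i \<in> {1..k} \<Longrightarrow> Z a i = U i" and v: "\<And>i. i \<in> {1..k} \<Longrightarrow> Z b i = V i"
  shows "lifts \<alpha> a b (steps U) (steps V)"
proof (rule liftsI[of _ _ "\<lambda>t. steps (Z t)" _ 1 _ 1])
  show "cmod (\<Sum>i\<in>{1..k}. steps (Z t) i) = \<alpha> t" if "t \<in> {a..b}" for t
    using sum_steps[of k "Z t"] k[OF that] k_ge_2 by simp
  show "continuous_on {a..b} (\<lambda>t. steps (Z t) i)" if "i \<in> {1..k}" for i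
    using that by (intro continuous_on_steps c)
  show "cmod (steps (Z t) i) = l i" if "t \<in> {a..b}" "i \<in> {1..k}" for i t
    by (intro cmod_steps 1 d that)
  show "steps (Z a) i = 1 * steps U i" if "i \<in> {1..k}" for i
    using steps_cong[of "Z a" U, OF u that] by simp
  show "steps (Z b) i = 1 * steps V i" if "i \<in> {1..k}" for i
    using steps_cong[of "Z b" V, OF v that] by simp
qed auto

text \<open>Positive diagonals keep all bases of triangles away from 0, so for fixed signs the
  configuration depends continuously on the diagonals.\<close>

lemma config_lifts:
  assumes D: "\<And>j. continuous_on {a..b} (\<lambda>t. D t j)"
    "\<And>t. t \<in> {a..b} \<Longrightarrow> admissible (D t) \<and> positive (D t) \<and> D t k = \<alpha> t" and e: "signs e"
  shows "lifts \<alpha> a b (config (D a) e) (config (D b) e)"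
  unfolding config_def
proof (rule lifts_of_sums[where Z="\<lambda>t. chain 1 (of_real (l 1)) (D t) e"])
  fix t assume "t \<in> {a..b}"
  then have t: "admissible (D t)" "\<And>j. j \<in> {1..<k} \<Longrightarrow> D t j > 0" "D t k = \<alpha> t"
    using D(2) by (auto simp: positive_def)
  then have z: "cmod (of_real (l 1)) = D t 1"
    using l1_pos by (simp add: admissible_def)
  show "cmod (chain 1 (of_real (l 1)) (D t) e 1) = l 1"
    unfolding chain_start using l1_pos by simp
  show "cmod (chain 1 (of_real (l 1)) (D t) e k) = \<alpha> t"
    using cmod_chain[OF _ t(1,2) e z, of k] t k_ge_2 by simp
  show "cmod (chain 1 (of_real (l 1)) (D t) e (Suc j) - chain 1 (of_real (l 1)) (D t) e j) = l (Suc j)"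
    if "j \<in> {1..<k}" for j
    using cmod_chain_diff[OF _ t(1,2) e z, of j] that by auto
next
  fix j assume "j \<in> {1..k}"
  then show "continuous_on {a..b} (\<lambda>t. chain 1 (complex_of_real (l 1)) (D t) e j)"
    using D(2) l1_pos
    by (intro continuous_on_chain e D(1) continuous_intros) (auto simp: admissible_def positive_def)
qed auto

text \<open>Induction along the chain with \<open>tri_degenerate\<close>; the alternatives in
  \<open>deg\<close> are the three ways in which a triangle can be flat.\<close>

lemma config_degenerate:
  assumes d: "admissible d" "positive d" and e: "signs e"
    and deg: "\<And>j. j \<in> {1..<k} \<Longrightarrow> e (Suc j) \<noteq> e' (Suc j) \<Longrightarrow>
      d j = d (Suc j) + l (Suc j) \<or> d (Suc j) = d j + l (Suc j) \<or> l (Suc j) = d (Suc j) + d j"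
    and i: "i \<in> {1..k}"
  shows "config d e i = config d e' i"
proof -
  have "chain 1 (of_real (l 1)) d e j = chain 1 (of_real (l 1)) d e' j" if "1 \<le> j" "j \<le> k" for j
    using that
  proof (induction j rule: dec_induct)
    case base then show ?case by simp
  next
    case (step j)
    have j: "j \<in> {1..<k}" using step by auto
    have z: "cmod (of_real (l 1)) = d 1" using d(1) l1_pos by (simp add: admissible_def)
    have "cmod (chain 1 (of_real (l 1)) d e j) = d j"
      by (rule cmod_chain) (use d e j z in \<open>auto simp: positive_def\<close>)
    moreover have "d j > 0" using d(2) j by (auto simp: positive_def)
    ultimately have "tri (chain 1 (of_real (l 1)) d e j) (d (Suc j)) (l (Suc j)) (e (Suc j))
       = tri (chain 1 (of_real (l 1)) d e j) (d (Suc j)) (l (Suc j)) (e' (Suc j))"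
      using deg[OF j] by (cases "e (Suc j) = e' (Suc j)") (auto intro!: tri_degenerate)
    then show ?case using step by simp
  qed
  then show ?thesis using i by (auto simp: config_def steps_def)
qed

lemma cmod_config:
  assumes "admissible d" "positive d" "signs e"
  shows "i \<in> {1..k} \<Longrightarrow> cmod (config d e i) = l i" "cmod (\<Sum>i\<in>{1..k}. config d e i) = d k"
proof -
  have z: "cmod (of_real (l 1)) = d 1" using assms l1_pos by (simp add: admissible_def)
  have p: "\<And>j. j \<in> {1..<k} \<Longrightarrow> d j > 0" using assms by (simp add: positive_def)
  show "i \<in> {1..k} \<Longrightarrow> cmod (config d e i) = l i"
    unfolding config_def
    using z assms cmod_chain_diff[OF _ assms(1) p assms(3) z] l1_pos
    by (intro cmod_steps) (auto simp del: chain.simps simp: chain_start[of 1, simplified])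
  show "cmod (\<Sum>i\<in>{1..k}. config d e i) = d k"
    unfolding config_def using cmod_chain[OF _ assms(1) p assms(3) z, of k] k_ge_2
      sum_steps[of k "chain 1 (of_real (l 1)) d e"] by simp
qed

text \<open>Half of the time is spent on reaching \<open>folded\<close>, where all triangles except
  the first are flat. There \<open>e\<close> is exchanged for \<open>e'\<close>, which is possible
  because they agree at 2, and the other half leads to \<open>d'\<close>.\<close>

lemma lifts_same_side:
  assumes ab: "a < b" and \<alpha>: "continuous_on {a..b} \<alpha>" "\<And>t. t \<in> {a..b} \<Longrightarrow> feasible (\<alpha> t)"
    and d: "admissible d" "positive d" "d k = \<alpha> a" and d': "admissible d'" "positive d'" "d' k = \<alpha> b"
    and e: "signs e" "signs e'" "e 2 = e' 2"
  shows "lifts \<alpha> a b (config d e) (config d' e')"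
proof -
  define c where "c = (a + b) / 2"
  define f where "f = folded (\<alpha> c)"
  have c: "a < c" "c < b" using ab by (auto simp: c_def)
  then have "feasible (\<alpha> c)" using \<alpha> by auto
  then have f: "admissible f" "positive f" "f k = \<alpha> c"
    "\<And>j. j \<in> {2..<k} \<Longrightarrow> f j = f (Suc j) + l (Suc j) \<or> f (Suc j) = f j + l (Suc j)"
    unfolding f_def by (auto simp: folded)
  have s: "{a..c} \<subseteq> {a..b}" "{c..b} \<subseteq> {a..b}" using c by auto
  obtain D where D: "\<And>j. continuous_on {a..c} (\<lambda>t. D t j)" "D a = d" "D c = f"
    "\<And>t. t \<in> {a..c} \<Longrightarrow> admissible (D t) \<and> positive (D t) \<and> D t k = \<alpha> t"
    using admissible_path[OF c(1) continuous_on_subset[OF \<alpha>(1) s(1)], of d f] \<alpha>(2) s(1) d f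
    by blast
  obtain E where E: "\<And>j. continuous_on {c..b} (\<lambda>t. E t j)" "E c = f" "E b = d'"
    "\<And>t. t \<in> {c..b} \<Longrightarrow> admissible (E t) \<and> positive (E t) \<and> E t k = \<alpha> t"
    using admissible_path[OF c(2) continuous_on_subset[OF \<alpha>(1) s(2)], of f d'] \<alpha>(2) s(2) d' f
    by blast
  have "lifts \<alpha> a c (config d e) (config f e)"
    using config_lifts[of a c D \<alpha> e] D e by simp
  moreover have "lifts \<alpha> c b (config f e') (config d' e')"
    using config_lifts[of c b E \<alpha> e'] E e by simp
  moreover have "config f e' i = config f e i" if "i \<in> {1..k}" for i
  proof (rule config_degenerate[OF f(1,2) e(2) _ that])
    fix j assume "j \<in> {1..<k}" "e' (Suc j) \<noteq> e (Suc j)"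
    then have "j \<in> {2..<k}" using e(3) by (cases "j = 1") (auto simp: numeral_2_eq_2)
    then show "f j = f (Suc j) + l (Suc j) \<or> f (Suc j) = f j + l (Suc j) \<or> l (Suc j) = f (Suc j) + f j"
      using f(4) by blast
  qed
  ultimately show ?thesis
    using c lifts_rotate[of \<alpha> c b "config f e'" "config d' e'" 1 "config f e" 1]
    by (auto intro: lifts_trans[of \<alpha> a c])
qed

text \<open>The first edge is turned onto the real axis; lengths and orientations are then read off
  the partial sums, and \<open>tri_unique\<close> shows that \<open>chain\<close> rebuilds
  these.\<close>

lemma config_exhaust:
  assumes v: "\<And>i. i \<in> {1..k} \<Longrightarrow> cmod (v i) = l i"
    and nz: "\<And>j. j \<in> {1..<k} \<Longrightarrow> (\<Sum>i\<in>{1..j}. v i) \<noteq> 0"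
  obtains d e c where "admissible d" "positive d" "d k = cmod (\<Sum>i\<in>{1..k}. v i)" "signs e"
    "cmod c = 1" "\<And>i. i \<in> {1..k} \<Longrightarrow> v i = c * config d e i"
proof
  define c where "c = sgn (v 1)"
  define Z where "Z j = cnj c * (\<Sum>i\<in>{1..j}. v i)" for j
  define d where "d j = cmod (Z j)" for j
  define e :: "nat \<Rightarrow> real" where "e j = (if Im (cnj (Z (j - 1)) * Z j) \<ge> 0 then 1 else -1)" for j
  have v1: "cmod (v 1) = l 1" using v k_ge_2 by simp
  then have "v 1 \<noteq> 0" using l1_pos by auto
  then show c: "cmod c = 1" by (simp add: c_def norm_sgn)
  then have cc: "c * cnj c = 1" by (simp add: complex_norm_square[symmetric])
  have dZ: "d j = cmod (\<Sum>i\<in>{1..j}. v i)" for j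
    using c by (simp add: d_def Z_def norm_mult)
  then show "d k = cmod (\<Sum>i\<in>{1..k}. v i)" .
  have Z1: "Z 1 = of_real (l 1)"
  proof -
    have "v 1 = c * of_real (l 1)" using v1 \<open>v 1 \<noteq> 0\<close> l1_pos by (simp add: c_def sgn_eq)
    then show ?thesis using cc by (simp add: Z_def mult.assoc[symmetric] mult.commute[of "cnj c"])
  qed
  have ZS: "Z (Suc j) - Z j = cnj c * v (Suc j)" for j
    by (simp add: Z_def algebra_simps)
  have ZSl: "cmod (Z (Suc j) - Z j) = l (Suc j)" if "j < k" for j
    using that v[of "Suc j"] c by (simp add: ZS norm_mult)
  show "signs e" by (simp add: signs_def e_def)
  show "positive d" using nz by (simp add: positive_def dZ)
  show "admissible d"
    unfolding admissible_def
  proof (intro conjI ballI)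
    show "d 1 = l 1" using v1 by (simp add: dZ)
    fix j assume j: "j \<in> {1..<k}"
    have "cmod (Z (Suc j) - Z j) = l (Suc j)" using ZSl j by simp
    then show "\<bar>d j - l (Suc j)\<bar> \<le> d (Suc j)" "d (Suc j) \<le> d j + l (Suc j)"
      using norm_triangle_ineq[of "Z j" "Z (Suc j) - Z j"] norm_triangle_ineq4[of "Z (Suc j)" "Z j"]
        norm_triangle_ineq4[of "Z (Suc j)" "Z (Suc j) - Z j"]
      unfolding d_def by (auto simp: abs_le_iff)
  qed
  have ch: "chain 1 (of_real (l 1)) d e j = Z j" if "1 \<le> j" "j \<le> k" for j
    using that
  proof (induction j rule: dec_induct)
    case base then show ?case unfolding chain_start using Z1 by simp
  next
    case (step j)
    then have "Z j \<noteq> 0" using nz[of j] cc by (auto simp: Z_def)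
    then have "tri (Z j) (d (Suc j)) (l (Suc j)) (e (Suc j)) = Z (Suc j)"
      using ZSl[of j] step by (intro tri_unique) (auto simp: d_def e_def)
    then show ?case using step by simp
  qed
  show "v i = c * config d e i" if "i \<in> {1..k}" for i
  proof (cases "i = 1")
    case True
    then show ?thesis using ch[of 1] k_ge_2 by (simp add: config_def steps_def Z_def mult.assoc[symmetric] cc)
  next
    case False
    then have "1 \<le> i - 1" "i - 1 \<le> k" "Suc (i - 1) = i" using that by auto
    then have "config d e i = Z (Suc (i - 1)) - Z (i - 1)"
      using ch[of i] ch[of "i - 1"] that False by (simp add: config_def steps_def)
    then show ?thesis using False that unfolding ZS by (simp add: mult.assoc[symmetric] cc)
  qed
qed

end

section \<open>Vanishing diagonals\<close>

text \<open>All vectors are compared with one of them: in its frame they are real with known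
  modulus, hence determined up to sign.\<close>

lemma parallel_family:
  assumes "finite I" "\<And>i. i \<in> I \<Longrightarrow> cmod (u i) = r i" "\<And>i. i \<in> I \<Longrightarrow> r i > 0"
    "\<And>i j. i \<in> I \<Longrightarrow> j \<in> I \<Longrightarrow> Im (cnj (u i) * u j) = 0"
  obtains f and e :: "nat \<Rightarrow> real" where "cmod f = 1" "\<And>i. e i * e i = 1"
    "\<And>i. i \<in> I \<Longrightarrow> u i = of_real (e i * r i) * f"
proof (cases "I = {}")
  case True
  then show thesis by (intro that[of 1 "\<lambda>_. 1"]) auto
next
  case False
  then obtain i0 where i0: "i0 \<in> I" by auto
  define f where "f = sgn (u i0)"
  define e :: "nat \<Rightarrow> real" where "e i = (if Re (cnj f * u i) \<ge> 0 then 1 else -1)" for i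
  have "u i0 \<noteq> 0" using assms(2,3)[OF i0] by auto
  then have f: "cmod f = 1" by (simp add: f_def norm_sgn)
  then have ff: "f * cnj f = 1" by (simp add: complex_norm_square[symmetric])
  show thesis
  proof (rule that)
    show "cmod f = 1" by (rule f)
    show "e i * e i = 1" for i by (simp add: e_def)
    fix i assume i: "i \<in> I"
    define q where "q = cnj f * u i"
    have "Im q = Im (cnj (u i0) * u i) / cmod (u i0)"
      by (simp add: q_def f_def sgn_div_norm scaleR_conv_of_real field_simps)
    then have Im: "Im q = 0" using assms(4)[OF i0 i] by simp
    have "\<bar>Re q\<bar> = cmod q" using Im by (simp add: cmod_def)
    also have "\<dots> = r i" using f assms(2)[OF i] by (simp add: q_def norm_mult)
    finally have "Re q = e i * r i"
      by (auto simp: e_def q_def[symmetric] split: if_splits)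
    then have "q = of_real (e i * r i)" using Im by (simp add: complex_eq_iff)
    moreover have "u i = q * f" using ff by (simp add: q_def mult.commute mult.left_commute)
    ultimately show "u i = of_real (e i * r i) * f" by simp
  qed
qed

context linkage
begin

text \<open>Non-criticality in terms of lengths: the value of a collinear configuration is the
  modulus of a signed sum of lengths.\<close>

definition regular :: "real \<Rightarrow> bool" where
  "regular x \<longleftrightarrow> x > 0 \<and> (\<forall>e. signs e \<longrightarrow> \<bar>\<Sum>i\<in>{1..k}. e i * l i\<bar> \<noteq> x)"

text \<open>If the edges up to \<open>m\<close> were parallel to each other and so were the later
  ones, the first block would have signed sum 0 and the second \<plusminus>\<open>x\<close>.
  Together their signs write \<open>x\<close> as a signed sum of all lengths, even if the two lines
  differ. The case \<open>m = 0\<close> says that not all edges are parallel.\<close>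

lemma regular_not_two_lines:
  assumes x: "regular x" and u: "\<And>i. i \<in> {1..k} \<Longrightarrow> cmod (u i) = l i" "cmod (\<Sum>i\<in>{1..k}. u i) = x"
    and m: "m \<le> k" "(\<Sum>i\<in>{1..m}. u i) = 0"
  obtains p q where "p \<in> {1..k}" "q \<in> {1..k}" "Im (cnj (u p) * u q) \<noteq> 0" "p \<le> m \<longleftrightarrow> q \<le> m"
proof (rule ccontr)
  assume "\<not> thesis"
  then have par: "Im (cnj (u p) * u q) = 0" if "p \<in> {1..k}" "q \<in> {1..k}" "p \<le> m \<longleftrightarrow> q \<le> m" for p q
    using that \<open>\<And>q p. \<lbrakk>p \<in> {1..k}; q \<in> {1..k}; Im (cnj (u p) * u q) \<noteq> 0; (p \<le> m) = (q \<le> m)\<rbrakk> \<Longrightarrow> thesis\<close>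
    by blast
  obtain f e where f: "cmod f = 1" "\<And>i. e i * e i = (1::real)"
     "\<And>i. i \<in> {1..m} \<Longrightarrow> u i = of_real (e i * l i) * f"
    by (rule parallel_family[of "{1..m}" u l]) (use u m par l_pos in auto)
  obtain g h where g: "cmod g = 1" "\<And>i. h i * h i = (1::real)"
     "\<And>i. i \<in> {m+1..k} \<Longrightarrow> u i = of_real (h i * l i) * g"
    by (rule parallel_family[of "{m+1..k}" u l]) (use u m par l_pos in auto)
  have split: "{1..k} = {1..m} \<union> {m+1..k}" "{1..m} \<inter> {m+1..k} = {}" using m by auto
  have "0 = of_real (\<Sum>i\<in>{1..m}. e i * l i) * f"
    using m(2) f(3) by (simp add: sum_distrib_right)
  then have "complex_of_real (\<Sum>i\<in>{1..m}. e i * l i) = 0"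
    using f(1) by (metis mult_eq_0_iff norm_zero zero_neq_one)
  then have e0: "(\<Sum>i\<in>{1..m}. e i * l i) = 0" by (simp only: of_real_eq_0_iff)
  have "(\<Sum>i\<in>{1..k}. u i) = of_real (\<Sum>i\<in>{m+1..k}. h i * l i) * g"
  proof -
    have "(\<Sum>i\<in>{1..k}. u i) = (\<Sum>i\<in>{1..m}. u i) + (\<Sum>i\<in>{m+1..k}. u i)"
      unfolding split(1) by (rule sum.union_disjoint) auto
    then show ?thesis using m(2) g(3) by (simp add: sum_distrib_right)
  qed
  then have hx: "\<bar>\<Sum>i\<in>{m+1..k}. h i * l i\<bar> = x"
    using u(2) g(1) by (simp only: norm_mult norm_of_real mult_1_right)
  define s where "s i = (if i \<le> m then e i else h i)" for i
  have "(\<Sum>i\<in>{1..k}. s i * l i) = (\<Sum>i\<in>{1..m}. s i * l i) + (\<Sum>i\<in>{m+1..k}. s i * l i)"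
    unfolding split(1) by (rule sum.union_disjoint) auto
  also have "\<dots> = (\<Sum>i\<in>{1..m}. e i * l i) + (\<Sum>i\<in>{m+1..k}. h i * l i)"
    by (intro arg_cong2[where f="(+)"] sum.cong) (auto simp: s_def)
  finally have "\<bar>\<Sum>i\<in>{1..k}. s i * l i\<bar> = x" using e0 hx by simp
  moreover have "signs s" using f(2) g(2) by (simp add: signs_def s_def)
  ultimately show False using x by (auto simp: regular_def)
qed

text \<open>The edges \<open>p\<close> and \<open>q\<close> follow the prescribed endpoint while edge \<open>r\<close> rotates freely.\<close>
lemma shake:
  fixes a b \<sigma> :: real
  assumes ab: "a < b" and \<alpha>: "continuous_on {a..b} \<alpha>" "\<And>t. t \<in> {a..b} \<Longrightarrow> \<alpha> t \<ge> 0" "\<alpha> a > 0"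
    and u: "\<And>i. i \<in> {1..k} \<Longrightarrow> cmod (u i) = l i" "cmod (\<Sum>i\<in>{1..k}. u i) = \<alpha> a"
    and pqr: "{p, q, r} \<subseteq> {1..k}" "p \<noteq> r" "q \<noteq> r" "Im (cnj (u p) * u q) \<noteq> 0"
    and N: "finite N" "\<And>j. j \<in> N \<Longrightarrow> j \<le> k \<and> (\<Sum>i\<in>{1..j}. u i) \<noteq> 0"
  obtains c \<beta> where "a < c" "c \<le> b" "\<And>i. continuous_on {a..c} (\<lambda>t. \<beta> t i)" "\<beta> a = u"
    "\<And>t i. t \<in> {a..c} \<Longrightarrow> i \<in> {1..k} \<Longrightarrow> cmod (\<beta> t i) = l i"
    "\<And>t. t \<in> {a..c} \<Longrightarrow> (\<Sum>i\<in>{1..k}. \<beta> t i) = of_real (\<alpha> t) * sgn (\<Sum>i\<in>{1..k}. u i)"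
    "\<And>t i. t \<in> {a..c} \<Longrightarrow> i \<noteq> p \<Longrightarrow> i \<noteq> q \<Longrightarrow> i \<noteq> r \<Longrightarrow> \<beta> t i = u i"
    "\<And>t. t \<in> {a..c} \<Longrightarrow> \<beta> t r = cis (\<sigma> * (t - a)) * u r"
    "\<And>t j. t \<in> {a..c} \<Longrightarrow> j \<in> N \<Longrightarrow> (\<Sum>i\<in>{1..j}. \<beta> t i) \<noteq> 0"
proof -
  define z where "z t = of_real (\<alpha> t) * sgn (\<Sum>i\<in>{1..k}. u i)" for t
  define w where "w t = cis (\<sigma> * (t - a)) * u r" for t
  \<comment> \<open>What the edges \<open>p\<close> and \<open>q\<close> must add up to: they make
    up for the shift of the endpoint along its ray and for the rotation of edge
    \<open>r\<close>.\<close>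
  define y where "y t = u p + u q + (z t - (\<Sum>i\<in>{1..k}. u i)) - (w t - u r)" for t
  have pq: "p \<noteq> q" using pqr(4) by auto
  have za: "z a = (\<Sum>i\<in>{1..k}. u i)"
    using \<alpha>(3) u(2) by (auto simp: z_def sgn_eq)
  have yc: "continuous_on {a..b} y"
    unfolding y_def z_def w_def by (intro continuous_intros \<alpha>(1))
  have ya: "y a = u p + u q" by (simp add: y_def za w_def)
  from parallelogram_move[OF ab yc ya pqr(4)]
  obtain c A where c: "a < c" "c \<le> b" "continuous_on {a..c} A" "A a = u p"
    "\<And>t. t \<in> {a..c} \<Longrightarrow> cmod (A t) = cmod (u p)"
    "\<And>t. t \<in> {a..c} \<Longrightarrow> cmod (y t - A t) = cmod (u q)" by blast
  define \<beta> where "\<beta> t i = (if i = p then A t else if i = q then y t - A t else if i = r then w t else u i)" for t i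
  have yc': "continuous_on {a..c} y" using yc c by (auto elim: continuous_on_subset)
  have cont: "continuous_on {a..c} (\<lambda>t. \<beta> t i)" for i
    unfolding \<beta>_def w_def using c(3) yc'
    by (cases "i = p"; cases "i = q"; cases "i = r") (auto intro!: continuous_intros)
  have wa: "w a = u r" by (simp add: w_def)
  have \<beta>a: "\<beta> a = u" using c(4) pq by (auto simp: \<beta>_def fun_eq_iff ya wa)
  have "\<forall>j\<in>N. \<forall>\<^sub>F t in at a within {a..c}. (\<Sum>i\<in>{1..j}. \<beta> t i) \<noteq> 0"
  proof
    fix j assume j: "j \<in> N"
    have "continuous_on {a..c} (\<lambda>t. \<Sum>i\<in>{1..j}. \<beta> t i)"
      by (intro continuous_intros cont)
    then have "((\<lambda>t. \<Sum>i\<in>{1..j}. \<beta> t i) \<longlongrightarrow> (\<Sum>i\<in>{1..j}. \<beta> a i)) (at a within {a..c})"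
      using c(1) by (auto simp: continuous_on_def)
    then show "\<forall>\<^sub>F t in at a within {a..c}. (\<Sum>i\<in>{1..j}. \<beta> t i) \<noteq> 0"
      by (rule tendsto_imp_eventually_ne) (use N(2)[OF j] \<beta>a in simp)
  qed
  then have "\<forall>\<^sub>F t in at a within {a..c}. \<forall>j\<in>N. (\<Sum>i\<in>{1..j}. \<beta> t i) \<noteq> 0"
    using N(1) by (simp add: eventually_ball_finite)
  then obtain e where e: "e > 0" "\<And>t. t \<in> {a..c} \<Longrightarrow> t \<noteq> a \<Longrightarrow> dist t a < e \<Longrightarrow>
      \<forall>j\<in>N. (\<Sum>i\<in>{1..j}. \<beta> t i) \<noteq> 0"
    unfolding eventually_at by auto
  define c' where "c' = min c (a + e / 2)"
  have c': "a < c'" "c' \<le> c" using e(1) c(1) by (auto simp: c'_def)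
  show thesis
  proof (rule that[of c' \<beta>])
    show "continuous_on {a..c'} (\<lambda>t. \<beta> t i)" for i
      by (rule continuous_on_subset[OF cont]) (use c' in auto)
  next
    fix t i assume t: "t \<in> {a..c'}"
    show "i \<in> {1..k} \<Longrightarrow> cmod (\<beta> t i) = l i"
      using t c' c(5)[of t] c(6)[of t] u(1) pqr(1) by (auto simp: \<beta>_def w_def norm_mult)
  next
    fix t assume t: "t \<in> {a..c'}"
    have "\<beta> t i - u i = (if i = p then A t - u p else 0) + (if i = q then y t - A t - u q else 0)
         + (if i = r then w t - u r else 0)" for i
      using pqr pq by (auto simp: \<beta>_def)
    then have "(\<Sum>i\<in>{1..k}. \<beta> t i - u i) = (A t - u p) + (y t - A t - u q) + (w t - u r)"
      using pqr(1) by (simp add: sum.distrib)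
    also have "\<dots> = z t - (\<Sum>i\<in>{1..k}. u i)" by (simp add: y_def)
    finally show "(\<Sum>i\<in>{1..k}. \<beta> t i) = of_real (\<alpha> t) * sgn (\<Sum>i\<in>{1..k}. u i)"
      by (simp add: sum_subtractf z_def)
  next
    fix t j assume t: "t \<in> {a..c'}" and j: "j \<in> N"
    show "(\<Sum>i\<in>{1..j}. \<beta> t i) \<noteq> 0"
    proof (cases "t = a")
      case True then show ?thesis using \<beta>a N(2)[OF j] by simp
    next
      case False
      then have "dist t a < e" using t e(1) by (auto simp: c'_def dist_real_def)
      then show ?thesis using e(2)[of t] False t c' j by auto
    qed
  qed (use c' c cont \<beta>a pqr in \<open>auto simp: \<beta>_def w_def elim: continuous_on_subset\<close>)
qed

text \<open>Zeros are removed one index at a time; the earlier diagonals are protected by the set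
  \<open>N\<close> of \<open>shake\<close>, and \<open>c < b\<close> leaves time for the next
  index.\<close>

lemma remove_zero_diagonal:
  fixes a b :: real
  assumes ab: "a < b" and \<alpha>: "continuous_on {a..b} \<alpha>" "\<And>t. t \<in> {a..b} \<Longrightarrow> \<alpha> t \<ge> 0" "regular (\<alpha> a)"
    and u: "\<And>i. i \<in> {1..k} \<Longrightarrow> cmod (u i) = l i" "cmod (\<Sum>i\<in>{1..k}. u i) = \<alpha> a"
    and m: "m \<in> {2..<k}" "\<And>j. j \<in> {1..<m} \<Longrightarrow> (\<Sum>i\<in>{1..j}. u i) \<noteq> 0"
  shows "\<exists>c v. a \<le> c \<and> c < b \<and> lifts \<alpha> a c u v \<and> (\<forall>j\<in>{1..m}. (\<Sum>i\<in>{1..j}. v i) \<noteq> 0)"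
proof (cases "(\<Sum>i\<in>{1..m}. u i) = 0")
  case False
  then have "(\<Sum>i\<in>{1..j}. u i) \<noteq> 0" if "j \<in> {1..m}" for j
    using m(2)[of j] that by (cases "j = m") auto
  moreover have "lifts \<alpha> a a u u" using u by (rule lifts_refl)
  ultimately show ?thesis using ab by blast
next
  case True
  obtain p q where pq: "p \<in> {1..k}" "q \<in> {1..k}" "Im (cnj (u p) * u q) \<noteq> 0" "p \<le> m \<longleftrightarrow> q \<le> m"
    using regular_not_two_lines[OF \<alpha>(3) u _ True] m(1) by auto
  \<comment> \<open>The free edge lies in the block, up to \<open>m\<close> or after it, that does
    not contain \<open>p\<close> and \<open>q\<close>. In this block only \<open>r\<close> moves, so
    it yields diagonal \<open>m\<close> explicitly, directly or as the endpoint minus the later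
    edges, whatever \<open>p\<close> and \<open>q\<close> do.\<close>
  define r where "r = (if p \<le> m then k else 1)"
  have r: "{p, q, r} \<subseteq> {1..k}" "p \<noteq> r" "q \<noteq> r" using pq m(1) by (auto simp: r_def)
  have \<alpha>a: "\<alpha> a > 0" using \<alpha>(3) by (simp add: regular_def)
  have N: "finite {1..<m}" "\<And>j. j \<in> {1..<m} \<Longrightarrow> j \<le> k \<and> (\<Sum>i\<in>{1..j}. u i) \<noteq> 0"
    using m by auto
  have sg: "cmod (sgn (\<Sum>i\<in>{1..k}. u i)) = 1" using u(2) \<alpha>a by (auto simp: norm_sgn)
  define K where "K t = (if p \<le> m then of_real (\<alpha> t) * sgn (\<Sum>i\<in>{1..k}. u i) - (\<Sum>i\<in>{m+1..<k}. u i)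
    else (\<Sum>i\<in>{2..m}. u i))" for t
  define \<rho> where "\<rho> = (if p \<le> m then - u k else u 1)"
  have "u 1 \<noteq> 0" "u k \<noteq> 0"
    using u(1)[of 1] u(1)[of k] l_pos[of 1] l_pos[of k] k_ge_2 by auto
  then have \<rho>: "\<rho> \<noteq> 0" by (simp add: \<rho>_def)
  have ex: "\<exists>c>a. \<forall>t\<in>{a<..c}. \<exists>v. lifts \<alpha> a t u v \<and> (\<forall>j\<in>{1..<m}. (\<Sum>i\<in>{1..j}. v i) \<noteq> 0) \<and>
      (\<Sum>i\<in>{1..m}. v i) = K t + \<rho> * cis (\<sigma> * (t - a))" for \<sigma> :: real
  proof -
    obtain c \<beta> where c: "a < c" "c \<le> b"
      and \<beta>: "\<And>i. continuous_on {a..c} (\<lambda>t. \<beta> t i)" "\<beta> a = u"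
      "\<And>t i. t \<in> {a..c} \<Longrightarrow> i \<in> {1..k} \<Longrightarrow> cmod (\<beta> t i) = l i"
      "\<And>t. t \<in> {a..c} \<Longrightarrow> (\<Sum>i\<in>{1..k}. \<beta> t i) = of_real (\<alpha> t) * sgn (\<Sum>i\<in>{1..k}. u i)"
      "\<And>t i. t \<in> {a..c} \<Longrightarrow> i \<noteq> p \<Longrightarrow> i \<noteq> q \<Longrightarrow> i \<noteq> r \<Longrightarrow> \<beta> t i = u i"
      "\<And>t. t \<in> {a..c} \<Longrightarrow> \<beta> t r = cis (\<sigma> * (t - a)) * u r"
      "\<And>t j. t \<in> {a..c} \<Longrightarrow> j \<in> {1..<m} \<Longrightarrow> (\<Sum>i\<in>{1..j}. \<beta> t i) \<noteq> 0"
      by (rule shake[OF ab \<alpha>(1,2) \<alpha>a u r pq(3) N, where \<sigma>=\<sigma>]) blast+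
    have "lifts \<alpha> a t u (\<beta> t) \<and> (\<forall>j\<in>{1..<m}. (\<Sum>i\<in>{1..j}. \<beta> t i) \<noteq> 0) \<and>
      (\<Sum>i\<in>{1..m}. \<beta> t i) = K t + \<rho> * cis (\<sigma> * (t - a))" if t: "t \<in> {a<..c}" for t
    proof (intro conjI ballI)
      have T: "t \<in> {a..c}" and s: "{a..t} \<subseteq> {a..c}" using t by auto
      show "lifts \<alpha> a t u (\<beta> t)"
      proof (rule liftsI[of _ _ \<beta> _ 1 _ 1])
        show "continuous_on {a..t} (\<lambda>t. \<beta> t i)" for i
          by (rule continuous_on_subset[OF \<beta>(1) s])
      next
        fix t' assume "t' \<in> {a..t}"
        then have "t' \<in> {a..c}" "t' \<in> {a..b}" using s c by auto
        then show "cmod (\<Sum>i\<in>{1..k}. \<beta> t' i) = \<alpha> t'"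
          using \<beta>(4) \<alpha>(2) sg by (simp add: norm_mult)
      next
        fix t' i assume "t' \<in> {a..t}" "i \<in> {1..k}"
        then show "cmod (\<beta> t' i) = l i" using \<beta>(3)[of t' i] s by auto
      qed (use \<beta>(1,2) s in \<open>auto elim: continuous_on_subset\<close>)
      show "(\<Sum>i\<in>{1..j}. \<beta> t i) \<noteq> 0" if "j \<in> {1..<m}" for j
        using \<beta>(7)[OF T that] .
      show "(\<Sum>i\<in>{1..m}. \<beta> t i) = K t + \<rho> * cis (\<sigma> * (t - a))"
      proof (cases "p \<le> m")
        case True
        have rk: "r = k" using True by (simp add: r_def)
        have "(\<Sum>i\<in>{1..k}. \<beta> t i) = (\<Sum>i\<in>{1..m}. \<beta> t i) + (\<Sum>i\<in>{m+1..k}. \<beta> t i)"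
          by (subst sum.union_disjoint[symmetric]) (use m in \<open>auto intro!: sum.cong\<close>)
        moreover have "(\<Sum>i\<in>{m+1..k}. \<beta> t i) = \<beta> t k + (\<Sum>i\<in>{m+1..<k}. \<beta> t i)"
        proof -
          have "{m+1..k} = insert k {m+1..<k}" using m by auto
          then show ?thesis by simp
        qed
        moreover have "(\<Sum>i\<in>{m+1..<k}. \<beta> t i) = (\<Sum>i\<in>{m+1..<k}. u i)"
          by (intro sum.cong refl \<beta>(5)[OF T]) (use True pq(4) rk in auto)
        ultimately show ?thesis
          using \<beta>(4)[OF T] \<beta>(6)[OF T] rk True by (simp add: K_def \<rho>_def algebra_simps)
      next
        case False
        have rk: "r = 1" using False by (simp add: r_def)
        have "(\<Sum>i\<in>{1..m}. \<beta> t i) = \<beta> t 1 + (\<Sum>i\<in>{2..m}. \<beta> t i)"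
        proof -
          have "{1..m} = insert 1 {2..m}" using m by auto
          then show ?thesis by simp
        qed
        moreover have "(\<Sum>i\<in>{2..m}. \<beta> t i) = (\<Sum>i\<in>{2..m}. u i)"
          by (intro sum.cong refl \<beta>(5)[OF T]) (use False pq(4) rk in auto)
        ultimately show ?thesis
          using \<beta>(6)[OF T] rk False by (simp add: K_def \<rho>_def algebra_simps)
      qed
    qed
    then show ?thesis using c(1) by blast
  qed
  \<comment> \<open>Rotating edge \<open>r\<close> in the two opposite senses gives two different
    positions of diagonal \<open>m\<close> at a common time, so one of them is not 0. The bound
    \<open>a + 1\<close> on this time makes the sine of the angle positive.\<close>
  obtain c1 where c1: "a < c1" "\<forall>t\<in>{a<..c1}. \<exists>v. lifts \<alpha> a t u v \<and>
      (\<forall>j\<in>{1..<m}. (\<Sum>i\<in>{1..j}. v i) \<noteq> 0) \<and> (\<Sum>i\<in>{1..m}. v i) = K t + \<rho> * cis (1 * (t - a))"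
    using ex[of 1] by blast
  obtain c2 where c2: "a < c2" "\<forall>t\<in>{a<..c2}. \<exists>v. lifts \<alpha> a t u v \<and>
      (\<forall>j\<in>{1..<m}. (\<Sum>i\<in>{1..j}. v i) \<noteq> 0) \<and> (\<Sum>i\<in>{1..m}. v i) = K t + \<rho> * cis (-1 * (t - a))"
    using ex[of "-1"] by blast
  define t where "t = min (min c1 c2) (min ((a + b) / 2) (a + 1))"
  have t: "a < t" "t < b" "t \<le> a + 1" "t \<in> {a<..c1}" "t \<in> {a<..c2}"
  proof -
    have "t \<le> c1" "t \<le> c2" "t \<le> (a + b) / 2" "t \<le> a + 1"
      unfolding t_def by linarith+
    moreover have "a < t" using ab c1(1) c2(1) by (simp add: t_def)
    ultimately show "a < t" "t < b" "t \<le> a + 1" "t \<in> {a<..c1}" "t \<in> {a<..c2}"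
      using ab by auto
  qed
  have "sin (t - a) > 0"
    using t pi_gt3 by (intro sin_gt_zero) auto
  moreover have "cis (1 * s) \<noteq> cis (-1 * s)" if "sin s > 0" for s
    using that by (auto simp: complex_eq_iff)
  ultimately have "cis (1 * (t - a)) \<noteq> cis (-1 * (t - a))"
    by blast
  then have "K t + \<rho> * cis (1 * (t - a)) \<noteq> K t + \<rho> * cis (-1 * (t - a))"
    using \<rho> by (simp only: add_left_cancel mult_left_cancel not_False_eq_True)
  then obtain v where v: "lifts \<alpha> a t u v" "\<forall>j\<in>{1..<m}. (\<Sum>i\<in>{1..j}. v i) \<noteq> 0" "(\<Sum>i\<in>{1..m}. v i) \<noteq> 0"
    using c1(2) c2(2) t(4,5) by metis
  then have "(\<Sum>i\<in>{1..j}. v i) \<noteq> 0" if "j \<in> {1..m}" for j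
    using that by (cases "j = m") auto
  then show ?thesis using t v(1) by (intro exI[of _ t] exI[of _ v]) auto
qed

lemma lifts_end:
  assumes "lifts \<alpha> a b u v" "a \<le> b"
  shows "i \<in> {1..k} \<Longrightarrow> cmod (v i) = l i" "cmod (\<Sum>i\<in>{1..k}. v i) = \<alpha> b"
proof -
  obtain \<beta> c where \<beta>: "\<forall>i\<in>{1..k}. cmod (\<beta> b i) = l i" "cmod (\<Sum>i\<in>{1..k}. \<beta> b i) = \<alpha> b"
    and c: "cmod c = 1" "\<forall>i\<in>{1..k}. \<beta> b i = c * v i"
    using assms unfolding lifts_def by (metis atLeastAtMost_iff order_refl)
  show "i \<in> {1..k} \<Longrightarrow> cmod (v i) = l i" using \<beta>(1) c by (auto simp: norm_mult)
  have "(\<Sum>i\<in>{1..k}. \<beta> b i) = c * (\<Sum>i\<in>{1..k}. v i)" using c by (simp add: sum_distrib_left)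
  then show "cmod (\<Sum>i\<in>{1..k}. v i) = \<alpha> b" using \<beta>(2) c(1) by (simp add: norm_mult)
qed

lemma lifts_to_config:
  fixes b :: real
  assumes b: "0 < b" and \<alpha>: "continuous_on {0..b} \<alpha>" "\<And>t. t \<in> {0..b} \<Longrightarrow> regular (\<alpha> t)"
    and u: "\<And>i. i \<in> {1..k} \<Longrightarrow> cmod (u i) = l i" "cmod (\<Sum>i\<in>{1..k}. u i) = \<alpha> 0"
  obtains c d e where "0 \<le> c" "c < b" "admissible d" "positive d" "d k = \<alpha> c" "signs e"
    "lifts \<alpha> 0 c u (config d e)"
proof -
  have "\<exists>c v. 0 \<le> c \<and> c < b \<and> lifts \<alpha> 0 c u v \<and> (\<forall>j\<in>{1..m}. (\<Sum>i\<in>{1..j}. v i) \<noteq> 0)"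
    if "1 \<le> m" "m < k" for m
    using that
  proof (induction m rule: dec_induct)
    case base
    have "u 1 \<noteq> 0" using u(1)[of 1] l1_pos k_ge_2 by auto
    then show ?case using b u lifts_refl[of u \<alpha> 0] by (intro exI[of _ 0] exI[of _ u]) auto
  next
    case (step m)
    then obtain c v where c: "0 \<le> c" "c < b" "lifts \<alpha> 0 c u v" "\<forall>j\<in>{1..m}. (\<Sum>i\<in>{1..j}. v i) \<noteq> 0"
      by auto
    have \<alpha>': "continuous_on {c..b} \<alpha>" "\<And>t. t \<in> {c..b} \<Longrightarrow> \<alpha> t \<ge> 0" "regular (\<alpha> c)"
      using \<alpha> c by (auto simp: regular_def less_imp_le elim: continuous_on_subset)
    have m: "Suc m \<in> {2..<k}" "\<And>j. j \<in> {1..<Suc m} \<Longrightarrow> (\<Sum>i\<in>{1..j}. v i) \<noteq> 0"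
      using step c(4) by auto
    from remove_zero_diagonal[OF c(2) \<alpha>' lifts_end[OF c(3,1)] m]
    obtain c' v' where "c \<le> c'" "c' < b" "lifts \<alpha> c c' v v'" "\<forall>j\<in>{1..Suc m}. (\<Sum>i\<in>{1..j}. v' i) \<noteq> 0"
      by auto
    then show ?case using lifts_trans[OF c(3)] c(1) by (intro exI[of _ c'] exI[of _ v']) auto
  qed
  from this[of "k - 1"] have "\<exists>c v. 0 \<le> c \<and> c < b \<and> lifts \<alpha> 0 c u v \<and> (\<forall>j\<in>{1..k-1}. (\<Sum>i\<in>{1..j}. v i) \<noteq> 0)"
    using k_ge_2 by simp
  then obtain c v where c: "0 \<le> c" "c < b" "lifts \<alpha> 0 c u v"
    "\<forall>j\<in>{1..k-1}. (\<Sum>i\<in>{1..j}. v i) \<noteq> 0"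
    by blast
  note v = lifts_end[OF c(3,1)]
  have nz: "(\<Sum>i\<in>{1..j}. v i) \<noteq> 0" if "j \<in> {1..<k}" for j
    using c(4) that by auto
  obtain d e r where d: "admissible d" "positive d" "d k = cmod (\<Sum>i\<in>{1..k}. v i)" "signs e"
    "cmod r = 1" "\<And>i. i \<in> {1..k} \<Longrightarrow> v i = r * config d e i"
    using config_exhaust[OF v(1) nz] by blast
  show thesis
    using that[OF c(1,2) d(1,2) _ d(4)] d v(2) lifts_rotate[OF c(3), of 1 u r "config d e"] by auto
qed

text \<open>Only the signs at \<open>1..k\<close> matter, so there are finitely many signed sums and
  the non-regular values form a closed set.\<close>

lemma regular_nbhd:
  assumes \<alpha>: "continuous_on {0..1::real} \<alpha>" "regular (\<alpha> 0)"
  obtains b where "0 < b" "b \<le> 1" "\<And>t. t \<in> {0..b} \<Longrightarrow> regular (\<alpha> t)"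
proof -
  define C where "C = {\<bar>\<Sum>i\<in>{1..k}. e i * l i\<bar> |e. signs e}"
  have "C \<subseteq> (\<lambda>S. \<bar>\<Sum>i\<in>{1..k}. (if i \<in> S then l i else - l i)\<bar>) ` Pow {1..k}"
  proof
    fix x assume "x \<in> C"
    then obtain e where e: "signs e" "x = \<bar>\<Sum>i\<in>{1..k}. e i * l i\<bar>" by (auto simp: C_def)
    have "e i = 1 \<or> e i = -1" for i using e(1) by (simp add: signs_def square_eq_1_iff)
    then have "(\<Sum>i\<in>{1..k}. e i * l i) = (\<Sum>i\<in>{1..k}. (if i \<in> {i\<in>{1..k}. e i = 1} then l i else - l i))"
      by (intro sum.cong) force+
    then show "x \<in> (\<lambda>S. \<bar>\<Sum>i\<in>{1..k}. (if i \<in> S then l i else - l i)\<bar>) ` Pow {1..k}"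
      using e(2) by (intro image_eqI[of _ _ "{i\<in>{1..k}. e i = 1}"]) auto
  qed
  then have "finite C" by (rule finite_subset) auto
  have R: "regular x \<longleftrightarrow> x \<notin> {..0} \<union> C" for x by (auto simp: regular_def C_def)
  have "closed ({..0} \<union> C)" using \<open>finite C\<close> by (intro closed_Un closed_atMost finite_imp_closed)
  then have cl: "closed {t \<in> {0..1}. \<alpha> t \<in> {..0} \<union> C}"
    using continuous_closed_preimage[OF \<alpha>(1), of "{..0} \<union> C"] by (simp add: vimage_def Int_def)
  have "0 \<notin> {t \<in> {0..1}. \<alpha> t \<in> {..0} \<union> C}" using \<alpha>(2) R by auto
  from separate_point_closed[OF cl this] obtain e where e: "e > 0" "\<forall>t\<in>{t \<in> {0..1}. \<alpha> t \<in> {..0} \<union> C}. e \<le> dist 0 t"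
    by blast
  show thesis
  proof
    show "0 < min (e / 2) 1" "min (e / 2) 1 \<le> 1" using e by auto
    show "regular (\<alpha> t)" if "t \<in> {0..min (e / 2) 1}" for t
      using that e unfolding R by (force simp: dist_real_def)
  qed
qed

end

section \<open>Flipping the first triangle\<close>

lemma continuous_on_sign_flip:
  fixes h :: "real \<Rightarrow> 'a::real_normed_vector"
  assumes "continuous_on {a..b} h" "h c = 0"
  shows "continuous_on {a..b} (\<lambda>t. (if t \<le> c then \<sigma> else - \<sigma>) *\<^sub>R h t)"
proof -
  have "continuous_on ({a..b} \<inter> {..c} \<union> {a..b} \<inter> {c..}) (\<lambda>t. if t \<le> c then \<sigma> *\<^sub>R h t else (- \<sigma>) *\<^sub>R h t)"
    by (rule continuous_on_If)
      (use assms in \<open>auto intro!: continuous_intros closed_Int elim: continuous_on_subset\<close>)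
  moreover have "{a..b} \<inter> {..c} \<union> {a..b} \<inter> {c..} = {a..b}" by auto
  moreover have "(\<lambda>t. (if t \<le> c then \<sigma> else - \<sigma>) *\<^sub>R h t) = (\<lambda>t. if t \<le> c then \<sigma> *\<^sub>R h t else (- \<sigma>) *\<^sub>R h t)"
    by auto
  ultimately show ?thesis by (simp only:)
qed

text \<open>Meant for a quotient that is 0 / 0 at \<open>c\<close>: there continuity comes from the
  majorant \<open>G\<close> alone.\<close>

lemma continuous_on_squeeze_point:
  fixes f :: "real \<Rightarrow> real"
  assumes "continuous_on (S - {c}) f" "continuous_on S G" "G c = 0" "f c = 0"
    "\<And>t. t \<in> S \<Longrightarrow> \<bar>f t\<bar> \<le> G t"
  shows "continuous_on S f"
  unfolding continuous_on_def
proof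
  fix x assume x: "x \<in> S"
  show "(f \<longlongrightarrow> f x) (at x within S)"
  proof (cases "x = c")
    case True
    have "(G \<longlongrightarrow> 0) (at c within S)"
      using assms(2,3) x True by (auto simp: continuous_on_def)
    then have "(f \<longlongrightarrow> 0) (at c within S)"
      by (rule Lim_null_comparison[rotated]) (use assms(5) in \<open>auto simp: eventually_at_filter\<close>)
    then show ?thesis using True assms(4) by simp
  next
    case False
    have "at x within S = at x within (S - {c})"
      by (rule at_within_nhd[of x "- {c}"]) (use False in auto)
    then show ?thesis using assms(1) x False by (auto simp: continuous_on_def)
  qed
qed

context linkage
begin

lemma admissibleD:
  assumes "admissible d"
  shows "d 1 = l 1" "j \<in> {1..<k} \<Longrightarrow> \<bar>d j - l (Suc j)\<bar> \<le> d (Suc j)"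
    "j \<in> {1..<k} \<Longrightarrow> d (Suc j) \<le> d j + l (Suc j)"
  using assms by (auto simp: admissible_def)

lemma chain_cong_signs:
  assumes "\<And>j. j > n \<Longrightarrow> e j = e' j"
  shows "chain n z d e j = chain n z d e' j"
  by (induction j) (use assms in auto)

lemma sums_admissible:
  assumes "\<And>i. i \<in> {1..k} \<Longrightarrow> cmod (u i) = l i"
  shows "admissible (\<lambda>j. cmod (\<Sum>i\<in>{1..j}. u i))"
  unfolding admissible_def
proof (intro conjI ballI)
  show "cmod (\<Sum>i\<in>{1..1}. u i) = l 1" using assms k_ge_2 by simp
  fix j assume "j \<in> {1..<k}"
  then have "cmod (u (Suc j)) = l (Suc j)" using assms by simp
  then show "\<bar>cmod (\<Sum>i\<in>{1..j}. u i) - l (Suc j)\<bar> \<le> cmod (\<Sum>i\<in>{1..Suc j}. u i)"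
    "cmod (\<Sum>i\<in>{1..Suc j}. u i) \<le> cmod (\<Sum>i\<in>{1..j}. u i) + l (Suc j)"
    using norm_triangle_ineq[of "\<Sum>i\<in>{1..j}. u i" "u (Suc j)"]
      norm_diff_ineq[of "\<Sum>i\<in>{1..j}. u i" "u (Suc j)"] norm_diff_ineq[of "u (Suc j)" "\<Sum>i\<in>{1..j}. u i"]
    by (auto simp: add.commute)
qed

lemma cmod_parallel:
  assumes "cmod p = a" "cmod q = b" "Im (cnj p * q) = 0" "b \<le> a"
  shows "cmod (p + q) = a + b \<or> cmod (p + q) = a - b"
proof -
  have "\<bar>Re (cnj p * q)\<bar> = cmod (cnj p * q)" using assms(3) by (simp add: cmod_def)
  then have "Re (cnj p * q) = a * b \<or> Re (cnj p * q) = - (a * b)"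
    using assms by (auto simp: norm_mult)
  moreover have "(cmod (p + q))\<^sup>2 = a\<^sup>2 + b\<^sup>2 + 2 * Re (cnj p * q)"
    unfolding assms(1,2)[symmetric] cmod_sq by (simp add: power2_eq_square algebra_simps)
  ultimately have "(cmod (p + q))\<^sup>2 = (a + b)\<^sup>2 \<or> (cmod (p + q))\<^sup>2 = (a - b)\<^sup>2"
    by (auto simp: power2_sum power2_diff)
  moreover have "0 \<le> b" using assms(2) by auto
  ultimately show ?thesis
    using assms(4) by (auto simp: power2_eq_iff_nonneg)
qed

text \<open>A vanishing interior diagonal has two nonzero neighbours, which leave room to enlarge it.\<close>
lemma fill_zero_diagonals:
  assumes "admissible d"
  obtains g where "admissible g" "g k = d k" "g 2 = d 2" "\<And>j. j \<in> {3..<k} \<Longrightarrow> g j > 0"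
proof
  \<comment> \<open>If \<open>d j = 0\<close>, the neighbours equal \<open>l j\<close> and
    \<open>l (Suc j)\<close>; they are positive, hence unchanged, and any value up to twice the
    smaller one closes both triangles. Index 2 is exempt, as its diagonal tells whether the first
    two edges are parallel.\<close>
  define g where "g j = (if j \<in> {3..<k} \<and> d j = 0 then min (l j) (l (Suc j)) else d j)" for j
  show "g k = d k" "g 2 = d 2" by (auto simp: g_def)
  show "g j > 0" if "j \<in> {3..<k}" for j
    using that l_pos[of j] l_pos[of "Suc j"] admissible_nonneg[OF assms, of j] by (auto simp: g_def)
  show "admissible g"
    unfolding admissible_def
  proof (intro conjI ballI)
    show "g 1 = l 1" using assms by (simp add: g_def admissible_def)
    fix j assume j: "j \<in> {1..<k}"
    have d: "\<bar>d j - l (Suc j)\<bar> \<le> d (Suc j)" "d (Suc j) \<le> d j + l (Suc j)"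
      using assms j by (auto simp: admissible_def)
    have l: "l j > 0" "l (Suc j) > 0" "Suc j < k \<Longrightarrow> l (Suc (Suc j)) > 0"
      using j by (auto intro!: l_pos)
    show "\<bar>g j - l (Suc j)\<bar> \<le> g (Suc j)" "g (Suc j) \<le> g j + l (Suc j)"
      using d l by (auto simp: g_def abs_le_iff min_def)
  qed
qed

text \<open>The strict inequalities leave time on both sides for \<open>lifts_same_side\<close>,
  which also needs the positive diagonals at \<open>s\<close> and \<open>s'\<close>. The passage
  through a vanishing diagonal takes place between \<open>s < s'\<close>.\<close>

definition flippable :: "(real \<Rightarrow> real) \<Rightarrow> real \<Rightarrow> real \<Rightarrow> real \<Rightarrow> bool" where
  "flippable \<alpha> a b \<sigma> \<longleftrightarrow> (\<exists>s s' d d' e e'. a < s \<and> s \<le> s' \<and> s' < b \<and>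
     admissible d \<and> positive d \<and> d k = \<alpha> s \<and> admissible d' \<and> positive d' \<and> d' k = \<alpha> s' \<and>
     signs e \<and> signs e' \<and> e 2 = \<sigma> \<and> e' 2 = - \<sigma> \<and> lifts \<alpha> s s' (config d e) (config d' e'))"

text \<open>The first triangle is flat at \<open>t0\<close>, so both signs give the same
  configuration and the flip takes no time.\<close>

lemma flippable_nonzero:
  assumes t0: "a < t0" "t0 < b" and g: "admissible g" "positive g" "g k = \<alpha> t0"
    and g2: "g 2 = l 1 + l 2 \<or> g 2 = l 1 - l 2" and \<sigma>: "\<sigma> * \<sigma> = 1"
  shows "flippable \<alpha> a b \<sigma>"
proof -
  define e where "e j = (if j = 2 then \<sigma> else 1)" for j :: nat
  define e' where "e' j = (if j = 2 then - \<sigma> else 1)" for j :: nat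
  have e: "signs e" "signs e'" using \<sigma> by (auto simp: signs_def e_def e'_def)
  have "config g e i = config g e' i" if "i \<in> {1..k}" for i
  proof (rule config_degenerate[OF g(1,2) e(1) _ that])
    fix j assume "e (Suc j) \<noteq> e' (Suc j)"
    then have "j = 1" by (auto simp: e_def e'_def split: if_splits)
    moreover have "g 1 = l 1" using g(1) by (simp add: admissible_def)
    ultimately show "g j = g (Suc j) + l (Suc j) \<or> g (Suc j) = g j + l (Suc j) \<or>
        l (Suc j) = g (Suc j) + g j"
      using g2 by (auto simp: numeral_2_eq_2)
  qed
  moreover have "lifts \<alpha> t0 t0 (config g e) (config g e)"
    using cmod_config[OF g(1,2) e(1)] g(3) by (intro lifts_refl) auto
  ultimately have "lifts \<alpha> t0 t0 (config g e) (config g e')"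
    by (elim lifts_rotate[of _ _ _ _ _ 1 _ 1]) auto
  then show ?thesis
    unfolding flippable_def using t0 g e
    by (intro exI[of _ t0] exI[of _ g] exI[of _ e] exI[of _ e']) (auto simp: e_def e'_def)
qed

text \<open>If \<open>l 1 = l 2\<close>, the first triangle can only degenerate to a point. The second diagonal is
  made to vanish so slowly that it meets the third one at a right angle in the limit; then the
  first two triangles can be reflected simultaneously.\<close>
lemma flippable_zero:
  fixes a b t0 \<sigma> :: real
  assumes t0: "a < t0" "t0 < b" and \<alpha>: "continuous_on {a..b} \<alpha>" "\<And>t. t \<in> {a..b} \<Longrightarrow> feasible (\<alpha> t)"
    and g: "admissible g" "g k = \<alpha> t0" "g 2 = 0" "\<And>j. j \<in> {3..<k} \<Longrightarrow> g j > 0"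
    and k: "k \<ge> 3" and \<sigma>: "\<sigma> * \<sigma> = 1"
  shows "flippable \<alpha> a b \<sigma>"
proof -
  note adm = admissibleD[OF g(1)]
  have l12: "l 2 = l 1" using adm(1) adm(2,3)[of 1] g(3) k by (simp add: numeral_2_eq_2[symmetric])
  have l3: "l 3 > 0" using k by (intro l_pos) auto
  have g3: "g 3 = l 3" using adm(2,3)[of 2] g(3) k l3 by simp
  define s1 where "s1 = (a + t0) / 2"
  define s2 where "s2 = (t0 + b) / 2"
  have s: "a < s1" "s1 < t0" "t0 < s2" "s2 < b" using t0 by (auto simp: s1_def s2_def)
  have sub: "{s1..s2} \<subseteq> {a..b}" using s by auto
  define S where "S = {s1..s2}"
  have \<alpha>S: "continuous_on S \<alpha>" "\<And>t. t \<in> S \<Longrightarrow> feasible (\<alpha> t)"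
    using \<alpha> sub by (auto simp: S_def elim: continuous_on_subset)
  \<comment> \<open>A preliminary path through \<open>g\<close>; its second diagonal is overwritten
    below by \<open>x\<close>.\<close>
  define D where "D t = section_through g (\<alpha> t)" for t
  have Dc: "continuous_on S (\<lambda>t. D t j)" for j
    unfolding D_def by (intro continuous_intros \<alpha>S)
  have D: "admissible (D t)" "D t k = \<alpha> t" "\<And>j. j \<in> {3..<k} \<Longrightarrow> D t j > 0" if "t \<in> S" for t
    unfolding D_def using \<alpha>S(2)[OF that] g
    by (auto intro!: section_through_admissible section_through_last section_through_pos)
  have Dt0: "D t0 = g" unfolding D_def g(2)[symmetric] by (rule section_through_self)
  define X where "X t = D t 3" for t
  \<comment> \<open>\<open>lo\<close> and \<open>up\<close> bound the second diagonals that fit both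
    the triangle with sides \<open>l 1\<close>, \<open>l 1\<close> and the one with sides
    \<open>l 3\<close>, \<open>X t\<close>.\<close>
  define lo where "lo t = \<bar>X t - l 3\<bar>" for t
  define up where "up t = min (2 * l 1) (X t + l 3)" for t
  \<comment> \<open>The root is clamped to the allowed range. Unless it is cut off by
    \<open>up\<close>, it gives \<open>lo t / x t \<le> sqrt (lo t)\<close>, which tends to 0 and
    forces the right angle; \<open>\<bar>t - t0\<bar>\<close> keeps \<open>x\<close> positive away
    from \<open>t0\<close>.\<close>
  define x where "x t = min (up t) (max (lo t) (sqrt (lo t + \<bar>t - t0\<bar>)))" for t
  have Xt0: "X t0 = l 3" by (simp add: X_def Dt0 g3)
  have X0: "X t \<ge> 0" if "t \<in> S" for t
    unfolding X_def using admissible_nonneg[OF D(1)[OF that], of 3] k by simp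
  have lo0: "lo t \<ge> 0" for t by (simp add: lo_def)
  have up0: "up t > 0" if "t \<in> S" for t using X0[OF that] l3 l1_pos by (simp add: up_def)
  have loup: "lo t \<le> up t" if "t \<in> S" for t
  proof -
    have "\<bar>D t 1 - l 2\<bar> \<le> D t 2" "D t 2 \<le> D t 1 + l 2" "\<bar>D t 2 - l 3\<bar> \<le> D t 3" "D t 3 \<le> D t 2 + l 3"
      "D t 1 = l 1"
      using admissibleD(1)[OF D(1)[OF that]] admissibleD(2,3)[OF D(1)[OF that], of 1]
        admissibleD(2,3)[OF D(1)[OF that], of 2] k by (auto simp: numeral_2_eq_2[symmetric])
    then show ?thesis using l12 by (auto simp: lo_def up_def X_def abs_le_iff)
  qed
  have x0: "x t \<ge> 0" "lo t \<le> x t" "x t \<le> up t" if "t \<in> S" for t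
    using up0[OF that] lo0[of t] loup[OF that] by (auto simp: x_def)
  have xpos: "x t > 0" if "t \<in> S" "t \<noteq> t0" for t
    using up0[OF that(1)] lo0[of t] that(2) by (auto simp: x_def less_max_iff_disj add_nonneg_pos)
  have xt0: "x t0 = 0" using l1_pos l3 by (simp add: x_def lo_def up_def Xt0)
  have x2: "x t \<le> 2 * l 1" if "t \<in> S" for t using x0[OF that] by (simp add: up_def)
  have Xc: "continuous_on S X" unfolding X_def by (rule Dc)
  have loc: "continuous_on S lo" unfolding lo_def by (intro continuous_intros Xc)
  have upc: "continuous_on S up" unfolding up_def by (intro continuous_intros Xc)
  have xc: "continuous_on S x" unfolding x_def by (intro continuous_intros loc upc)
  \<comment> \<open>\<open>E\<close> and \<open>F\<close> are cosine and sine of the base angle in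
    the isosceles triangle with legs \<open>l 1\<close> and base \<open>x t\<close>.
    \<open>A\<close> and \<open>B\<close> locate the third vertex along and across the second
    diagonal. At \<open>t0\<close> division by zero gives \<open>A t0 = 0\<close>, which is also the
    limit.\<close>
  define E where "E t = x t / (2 * l 1)" for t
  define F where "F t = sqrt (1 - (E t)\<^sup>2)" for t
  define A where "A t = ((X t)\<^sup>2 + (x t)\<^sup>2 - (l 3)\<^sup>2) / (2 * x t)" for t
  define B where "B t = sqrt ((X t)\<^sup>2 - (A t)\<^sup>2)" for t
  have Ec: "continuous_on S E" unfolding E_def using l1_pos by (intro continuous_intros xc) auto
  have Fc: "continuous_on S F" unfolding F_def by (intro continuous_intros Ec)
  have Et0: "E t0 = 0" by (simp add: E_def xt0)
  have At0: "A t0 = 0" by (simp add: A_def xt0)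
  have Ac: "continuous_on S A"
  proof (rule continuous_on_squeeze_point)
    show "continuous_on (S - {t0}) A"
      unfolding A_def using less_imp_neq[OF xpos]
      by (intro continuous_intros continuous_on_subset[OF Xc] continuous_on_subset[OF xc]) force+
    show "continuous_on S (\<lambda>t. (lo t / up t + sqrt (lo t)) * (X t + l 3) / 2 + x t / 2)"
      using up0 by (intro continuous_intros loc upc Xc xc) (auto simp: less_imp_neq[THEN not_sym])
    show "(lo t0 / up t0 + sqrt (lo t0)) * (X t0 + l 3) / 2 + x t0 / 2 = 0"
      by (simp add: lo_def Xt0 xt0)
    show "A t0 = 0" by (rule At0)
    fix t assume t: "t \<in> S"
    show "\<bar>A t\<bar> \<le> (lo t / up t + sqrt (lo t)) * (X t + l 3) / 2 + x t / 2"
    proof (cases "t = t0")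
      case True then show ?thesis using At0 by (simp add: lo_def Xt0 xt0)
    next
      case False
      \<comment> \<open>In \<open>A t\<close> the term \<open>x t / 2\<close> is harmless and the
        rest is \<open>(X t - l 3) / x t\<close> times a continuous factor. This quotient has
        modulus \<open>lo t / x t\<close>, at most \<open>lo t / up t\<close> where \<open>x\<close>
        is cut off and at most \<open>sqrt (lo t)\<close> elsewhere.\<close>
      note xp = xpos[OF t False]
      have "sqrt (lo t) \<le> sqrt (lo t + \<bar>t - t0\<bar>)" by simp
      then have "x t \<ge> up t \<or> x t \<ge> sqrt (lo t)"
        unfolding x_def by linarith
      then have "lo t / x t \<le> lo t / up t + sqrt (lo t)"
      proof
        assume "x t \<ge> up t"
        then have "lo t / x t \<le> lo t / up t" using up0[OF t] lo0 xp by (intro divide_left_mono) auto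
        then show ?thesis using lo0[of t] by (simp add: add_increasing2)
      next
        assume *: "x t \<ge> sqrt (lo t)"
        have "lo t = sqrt (lo t) * sqrt (lo t)" using lo0 by simp
        also have "\<dots> \<le> sqrt (lo t) * x t" using * lo0 by (intro mult_left_mono) auto
        finally have "lo t / x t \<le> sqrt (lo t)" using xp by (simp add: pos_divide_le_eq)
        moreover have "lo t / up t \<ge> 0" using lo0[of t] up0[OF t] by simp
        ultimately show ?thesis by simp
      qed
      then have "lo t / x t * (X t + l 3) / 2 \<le> (lo t / up t + sqrt (lo t)) * (X t + l 3) / 2"
        using X0[OF t] l3 by (intro divide_right_mono mult_right_mono) auto
      moreover have "A t = (X t - l 3) / x t * (X t + l 3) / 2 + x t / 2"
        using xp by (simp add: A_def field_simps power2_eq_square)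
      then have "\<bar>A t\<bar> \<le> \<bar>(X t - l 3) / x t * (X t + l 3) / 2\<bar> + \<bar>x t / 2\<bar>"
        by (metis abs_triangle_ineq)
      moreover have "\<bar>(X t - l 3) / x t * (X t + l 3) / 2\<bar> = lo t / x t * (X t + l 3) / 2"
        using xp X0[OF t] l3 by (simp add: abs_mult lo_def)
      ultimately show ?thesis using xp by linarith
    qed
  qed
  have Bc: "continuous_on S B" unfolding B_def by (intro continuous_intros Ac Xc)
  have EF: "(F t)\<^sup>2 = 1 - (E t)\<^sup>2" if "t \<in> S" for t
  proof -
    have "\<bar>E t\<bar> \<le> 1" using x0[OF that] x2[OF that] l1_pos by (simp add: E_def)
    then show ?thesis by (simp add: F_def abs_square_le_1)
  qed
  have AB: "(B t)\<^sup>2 = (X t)\<^sup>2 - (A t)\<^sup>2" if t: "t \<in> S" for t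
  proof (cases "t = t0")
    case False
    have "(A t)\<^sup>2 \<le> (X t)\<^sup>2"
      unfolding A_def
      by (rule tri_height_nonneg) (use xpos[OF t False] x0[OF t] in \<open>auto simp: lo_def up_def abs_le_iff\<close>)
    then show ?thesis by (simp add: B_def)
  qed (simp add: At0 B_def)
  have Ax: "2 * A t * x t = (X t)\<^sup>2 + (x t)\<^sup>2 - (l 3)\<^sup>2" if t: "t \<in> S" for t
  proof (cases "t = t0")
    case False then show ?thesis using xpos[OF t False] by (simp add: A_def)
  qed (simp add: xt0 Xt0)
  \<comment> \<open>Both orientations change at \<open>t0\<close>, where the direction
    \<open>e2\<close> jumps to its negative. \<open>Z2\<close> stays continuous because
    \<open>x t0 = 0\<close>. In \<open>Z3\<close> the sign occurs squared, or as a factor of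
    \<open>F A + E B\<close>, which vanishes at \<open>t0\<close> along with \<open>E\<close> and
    \<open>A\<close>.\<close>
  define sg where "sg t = (if t \<le> t0 then \<sigma> else - \<sigma>)" for t
  have sg: "sg t * sg t = 1" "(sg t)\<^sup>2 = 1" for t using \<sigma> by (auto simp: sg_def power2_eq_square)
  define e2 where "e2 t = Complex (E t) (sg t * F t)" for t
  define Z2 where "Z2 t = of_real (x t) * e2 t" for t
  define Z3 where "Z3 t = e2 t * Complex (A t) (sg t * B t)" for t
  have Z2c: "continuous_on S Z2"
  proof -
    have "Z2 t = of_real (x t * E t) + sg t *\<^sub>R (\<i> * of_real (x t * F t))" for t
      by (simp add: Z2_def e2_def complex_eq_iff)
    moreover have "continuous_on S (\<lambda>t. sg t *\<^sub>R (\<i> * of_real (x t * F t)))"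
      unfolding sg_def S_def
      by (rule continuous_on_sign_flip)
        (use xc Fc in \<open>auto simp: S_def xt0 intro!: continuous_intros\<close>)
    ultimately show ?thesis using xc Ec by (auto intro!: continuous_intros)
  qed
  have Z3c: "continuous_on S Z3"
  proof -
    have "Z3 t = of_real (E t * A t - F t * B t) + sg t *\<^sub>R (\<i> * of_real (F t * A t + E t * B t))" for t
      using sg(1)[of t] by (simp add: Z3_def e2_def complex_eq_iff algebra_simps)
    moreover have "continuous_on S (\<lambda>t. sg t *\<^sub>R (\<i> * of_real (F t * A t + E t * B t)))"
      unfolding sg_def S_def
      by (rule continuous_on_sign_flip)
        (use Ac Bc Ec Fc in \<open>auto simp: S_def Et0 At0 intro!: continuous_intros\<close>)
    ultimately show ?thesis using Ac Bc Ec Fc by (auto intro!: continuous_intros)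
  qed
  have ne2: "cmod (e2 t) = 1" if "t \<in> S" for t
  proof -
    have "(cmod (e2 t))\<^sup>2 = 1"
      unfolding cmod_sq by (simp add: e2_def power_mult_distrib sg EF[OF that])
    then show ?thesis using norm_ge_zero[of "e2 t"] by (simp add: power2_eq_1_iff)
  qed
  have nZ2: "cmod (Z2 t) = x t" if "t \<in> S" for t
    using x0[OF that] ne2[OF that] by (simp add: Z2_def norm_mult)
  have nZ21: "cmod (Z2 t - of_real (l 1)) = l 2" if t: "t \<in> S" for t
  proof -
    have "(cmod (Z2 t - of_real (l 1)))\<^sup>2 = (x t * E t - l 1)\<^sup>2 + (x t)\<^sup>2 * (F t)\<^sup>2"
      unfolding cmod_sq by (simp add: Z2_def e2_def power_mult_distrib sg)
    also have "\<dots> = (x t)\<^sup>2 - 2 * l 1 * E t * x t + (l 1)\<^sup>2"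
      unfolding EF[OF t] by (simp add: algebra_simps power2_eq_square)
    also have "2 * l 1 * E t = x t" using l1_pos by (simp add: E_def)
    finally show ?thesis using l12 l1_pos by (simp add: power2_eq_square[of "x t"] power2_eq_iff_nonneg)
  qed
  have nZ3: "cmod (Z3 t) = X t" if t: "t \<in> S" for t
  proof -
    have "(cmod (Complex (A t) (sg t * B t)))\<^sup>2 = (X t)\<^sup>2"
      unfolding cmod_sq by (simp add: power_mult_distrib sg AB[OF t])
    then show ?thesis using X0[OF t] ne2[OF t] by (simp add: Z3_def norm_mult power2_eq_iff_nonneg)
  qed
  have nZ32: "cmod (Z3 t - Z2 t) = l 3" if t: "t \<in> S" for t
  proof -
    have "(cmod (Complex (A t) (sg t * B t) - of_real (x t)))\<^sup>2 = (A t - x t)\<^sup>2 + (B t)\<^sup>2"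
      unfolding cmod_sq by (simp add: power_mult_distrib sg)
    also have "\<dots> = (X t)\<^sup>2 - 2 * A t * x t + (x t)\<^sup>2"
      by (simp add: AB[OF t] power2_diff)
    also have "\<dots> = (l 3)\<^sup>2" by (simp add: Ax[OF t])
    finally have "cmod (Complex (A t) (sg t * B t) - of_real (x t)) = l 3"
      using l3 by (simp add: power2_eq_iff_nonneg)
    moreover have "Z3 t - Z2 t = e2 t * (Complex (A t) (sg t * B t) - of_real (x t))"
      by (simp add: Z3_def Z2_def algebra_simps)
    ultimately show ?thesis using ne2[OF t] by (simp add: norm_mult)
  qed
  define D' where "D' t = (D t)(2 := x t)" for t
  have D'c: "continuous_on S (\<lambda>t. D' t j)" for j
    by (cases "j = 2") (auto simp: D'_def xc Dc)
  have D': "admissible (D' t)" "D' t k = \<alpha> t" "\<And>j. j \<in> {3..<k} \<Longrightarrow> D' t j > 0" if t: "t \<in> S" for t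
  proof -
    show "D' t k = \<alpha> t" "\<And>j. j \<in> {3..<k} \<Longrightarrow> D' t j > 0" using D[OF t] k by (auto simp: D'_def)
    have D1: "D t 1 = l 1" using D(1)[OF t] by (simp add: admissible_def)
    show "admissible (D' t)"
      unfolding admissible_def
    proof (intro conjI ballI)
      show "D' t 1 = l 1" using D1 by (simp add: D'_def)
      fix j assume j: "j \<in> {1..<k}"
      consider "j = 1" | "j = 2" | "j \<ge> 3" using j by force
      then have "\<bar>D' t j - l (Suc j)\<bar> \<le> D' t (Suc j) \<and> D' t (Suc j) \<le> D' t j + l (Suc j)"
      proof cases
        case 1
        then show ?thesis using D1 x0[OF t] x2[OF t] l12 by (auto simp: D'_def numeral_2_eq_2)
      next
        case 2
        then show ?thesis using x0[OF t]
          by (auto simp: D'_def lo_def up_def X_def[symmetric] abs_le_iff eval_nat_numeral X_def)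
      next
        case 3
        then show ?thesis using D(1)[OF t] j by (auto simp: D'_def admissible_def)
      qed
      then show "\<bar>D' t j - l (Suc j)\<bar> \<le> D' t (Suc j)" "D' t (Suc j) \<le> D' t j + l (Suc j)" by auto
    qed
  qed
  have D'pos: "positive (D' t)" if "t \<in> S" "t \<noteq> t0" for t
    unfolding positive_def
  proof
    fix j assume j: "j \<in> {1..<k}"
    consider "j = 1" | "j = 2" | "j \<ge> 3" using j by force
    then show "D' t j > 0"
      using D'(3)[OF that(1), of j] D'(1)[OF that(1)] j xpos[OF that] l1_pos
      by cases (auto simp: admissible_def D'_def)
  qed
  have ZD: "cmod (Z3 t) = D' t 3" if "t \<in> S" for t
    using nZ3[OF that] by (simp add: D'_def X_def)
  define one where "one = (\<lambda>_::nat. 1::real)"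
  have one: "signs one" by (simp add: one_def signs_def)
  \<comment> \<open>From the third vertex on, all bases of triangles are positive even at
    \<open>t0\<close>, so an ordinary chain with constant signs continues the path.\<close>
  define Z where "Z t j = (if j = 1 then of_real (l 1) else if j = 2 then Z2 t
     else chain 3 (Z3 t) (D' t) one j)" for t j
  define ee where "ee t = (\<lambda>j::nat. if j = 2 \<or> j = 3 then sg t else 1)" for t
  have ee: "signs (ee t)" for t using sg by (simp add: ee_def signs_def)
  \<comment> \<open>Away from \<open>t0\<close> the path consists of ordinary configurations with
    sign \<open>sg t\<close> at 2 and 3; this identifies its two ends.\<close>
  have match: "Z t i = chain 1 (of_real (l 1)) (D' t) (ee t) i" if t: "t \<in> S" "t \<noteq> t0" and i: "i \<in> {1..k}" for t i
  proof -
    have "tri (of_real (l 1)) (x t) (l 2) (sg t) = Z2 t"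
    proof (rule tri_unique[OF _ nZ2[OF t(1)] nZ21[OF t(1)] sg(1)])
      have "sg t * Im (cnj (of_real (l 1)) * Z2 t) = (sg t * sg t) * (l 1 * x t * F t)"
        by (simp add: Z2_def e2_def)
      also have "\<dots> \<ge> 0"
        using sg(1) x0[OF t(1)] l1_pos EF[OF t(1)] by (simp add: F_def)
      finally show "sg t * Im (cnj (of_real (l 1)) * Z2 t) \<ge> 0" .
    qed (use l1_pos in auto)
    then have c2: "chain 1 (of_real (l 1)) (D' t) (ee t) 2 = Z2 t"
      by (simp add: numeral_2_eq_2) (simp add: D'_def ee_def numeral_2_eq_2)
    have "tri (Z2 t) (X t) (l 3) (sg t) = Z3 t"
    proof (rule tri_unique[OF _ nZ3[OF t(1)] nZ32[OF t(1)] sg(1)])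
      have "cnj (Z2 t) * Z3 t = (e2 t * cnj (e2 t)) * (of_real (x t) * Complex (A t) (sg t * B t))"
        by (simp add: Z2_def Z3_def)
      also have "e2 t * cnj (e2 t) = 1" using ne2[OF t(1)] by (simp add: complex_norm_square[symmetric])
      finally have "sg t * Im (cnj (Z2 t) * Z3 t) = (sg t * sg t) * (x t * B t)" by simp
      also have "\<dots> \<ge> 0"
        using sg(1) x0[OF t(1)] AB[OF t(1)] by (simp add: B_def)
      finally show "sg t * Im (cnj (Z2 t) * Z3 t) \<ge> 0" .
    qed (use nZ2[OF t(1)] xpos[OF t] in auto)
    then have c3: "chain 1 (of_real (l 1)) (D' t) (ee t) 3 = Z3 t"
      using c2 by (simp add: numeral_3_eq_3) (simp add: D'_def X_def ee_def numeral_3_eq_3 numeral_2_eq_2)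
    consider "i = 1" | "i = 2" | "i \<ge> 3" using i by force
    then show ?thesis
    proof cases
      case 1 then show ?thesis by (simp add: Z_def)
    next
      case 2 then show ?thesis using c2 by (simp add: Z_def)
    next
      case 3
      have "chain 3 (Z3 t) (D' t) one i = chain 3 (Z3 t) (D' t) (ee t) i"
        by (rule chain_cong_signs) (simp add: one_def ee_def)
      also have "\<dots> = chain 1 (of_real (l 1)) (D' t) (ee t) i"
        by (rule chain_restart[OF c3 _ 3]) simp
      finally show ?thesis using 3 by (simp add: Z_def)
    qed
  qed
  have s12: "s1 \<in> S" "s2 \<in> S" "s1 \<noteq> t0" "s2 \<noteq> t0" using s by (auto simp: S_def)
  have "lifts \<alpha> s1 s2 (config (D' s1) (ee s1)) (config (D' s2) (ee s2))"
    unfolding config_def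
  proof (rule lifts_of_sums[where Z=Z])
    fix j assume "j \<in> {1..k}"
    then have j: "j \<le> k" "1 \<le> j" by auto
    consider "j = 1" | "j = 2" | "j \<ge> 3" using j by force
    then show "continuous_on {s1..s2} (\<lambda>t. Z t j)"
    proof cases
      case 3
      then have "continuous_on S (\<lambda>t. chain 3 (Z3 t) (D' t) one j)"
        by (intro continuous_on_chain one Z3c D'c ZD D'(1,3) j) auto
      then show ?thesis using 3 by (simp add: Z_def S_def)
    qed (use Z2c in \<open>auto simp: Z_def S_def\<close>)
  next
    fix t assume "t \<in> {s1..s2}"
    then have t: "t \<in> S" by (simp add: S_def)
    show "cmod (Z t 1) = l 1" using l1_pos by (simp add: Z_def)
    show "cmod (Z t k) = \<alpha> t"
      using cmod_chain[OF _ D'(1)[OF t] D'(3)[OF t] one ZD[OF t], of k] k D'(2)[OF t]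
      by (simp add: Z_def)
    fix j assume j: "j \<in> {1..<k}"
    consider "j = 1" | "j = 2" | "j \<ge> 3" using j by force
    then show "cmod (Z t (Suc j) - Z t j) = l (Suc j)"
    proof cases
      case 1 then show ?thesis using nZ21[OF t] by (simp add: Z_def numeral_2_eq_2)
    next
      case 2 then show ?thesis using nZ32[OF t] chain_start[of 3 "Z3 t" "D' t" one]
        by (simp add: Z_def numeral_3_eq_3[symmetric] del: chain.simps)
    next
      case 3 then show ?thesis
        using cmod_chain_diff[OF _ D'(1)[OF t] D'(3)[OF t] one ZD[OF t], of j] j
        by (simp add: Z_def del: chain.simps)
    qed
  qed (use match s12 in auto)
  moreover have "ee s1 2 = \<sigma>" "ee s2 2 = - \<sigma>" using s by (auto simp: ee_def sg_def)
  moreover have "s1 \<le> s2" using s by simp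
  ultimately show ?thesis
    unfolding flippable_def
    using s(1,4) D'(1,2)[OF s12(1)] D'(1,2)[OF s12(2)] D'pos[OF s12(1,3)] D'pos[OF s12(2,4)] ee
    by blast
qed

end

lemma parallel_trans:
  assumes "x \<noteq> 0" "Im (cnj x * y) = 0" "Im (cnj x * z) = 0"
  shows "Im (cnj y * z) = 0"
proof -
  have "(cmod x)\<^sup>2 * Im (cnj y * z) = Im (cnj (cnj x * y) * (cnj x * z))"
    unfolding cmod_sq by (simp add: power2_eq_square algebra_simps)
  also have "\<dots> = 0" using assms(2,3) by simp
  finally show ?thesis using assms(1) by simp
qed

context linkage
begin

text \<open>Parallel first edges mean a flat first triangle. Zero diagonals of higher index are
  filled. A zero second diagonal needs the special motion unless \<open>k = 2\<close>, when it is
  the last one and may vanish.\<close>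

lemma flippable_at:
  fixes a b t0 \<sigma> :: real
  assumes t0: "a < t0" "t0 < b" and \<alpha>: "continuous_on {a..b} \<alpha>" "\<And>t. t \<in> {a..b} \<Longrightarrow> feasible (\<alpha> t)"
    and u: "\<And>i. i \<in> {1..k} \<Longrightarrow> cmod (u i) = l i" "cmod (\<Sum>i\<in>{1..k}. u i) = \<alpha> t0"
      "Im (cnj (u 1) * u 2) = 0"
    and \<sigma>: "\<sigma> * \<sigma> = 1"
  shows "flippable \<alpha> a b \<sigma>"
proof -
  have "cmod (u 1 + u 2) = l 1 + l 2 \<or> cmod (u 1 + u 2) = l 1 - l 2"
    using u k_ge_2 l_2_le_1 by (intro cmod_parallel) auto
  moreover have "{1..2::nat} = {1,2}" by auto
  ultimately have d2: "cmod (\<Sum>i\<in>{1..2}. u i) = l 1 + l 2 \<or> cmod (\<Sum>i\<in>{1..2}. u i) = l 1 - l 2"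
    by simp
  obtain g where g: "admissible g" "g k = \<alpha> t0" "g 2 = cmod (\<Sum>i\<in>{1..2}. u i)"
     "\<And>j. j \<in> {3..<k} \<Longrightarrow> g j > 0"
    using fill_zero_diagonals[OF sums_admissible[of u]] u by metis
  show ?thesis
  proof (cases "g 2 = 0 \<and> k \<ge> 3")
    case True
    then show ?thesis using flippable_zero[OF t0 \<alpha> g(1,2) _ g(4) _ \<sigma>] by blast
  next
    case False
    have "positive g"
      unfolding positive_def
    proof
      fix j assume j: "j \<in> {1..<k}"
      consider "j = 1" | "j = 2" | "j \<ge> 3" using j by force
      then show "g j > 0"
        using admissibleD(1)[OF g(1)] l1_pos False j g(3) g(4)[of j] by cases auto
    qed
    then show ?thesis by (rule flippable_nonzero[OF t0 g(1) _ _ _ \<sigma>]) (use g d2 in auto)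
  qed
qed

text \<open>The parallel edges are kept parallel; if all other edges are parallel as well, then the
  sum of the first two moves like a single edge.\<close>
lemma parallel_nearby:
  fixes a b :: real
  assumes ab: "a < b" and \<alpha>: "continuous_on {a..b} \<alpha>" "\<And>t. t \<in> {a..b} \<Longrightarrow> \<alpha> t \<ge> 0" "regular (\<alpha> a)"
    and u: "\<And>i. i \<in> {1..k} \<Longrightarrow> cmod (u i) = l i" "cmod (\<Sum>i\<in>{1..k}. u i) = \<alpha> a"
      "Im (cnj (u 1) * u 2) = 0"
  shows "\<exists>t v. a < t \<and> t < b \<and> (\<forall>i\<in>{1..k}. cmod (v i) = l i) \<and> cmod (\<Sum>i\<in>{1..k}. v i) = \<alpha> t \<and>
    Im (cnj (v 1) * v 2) = 0"
proof -
  have \<alpha>a: "\<alpha> a > 0" using \<alpha>(3) by (simp add: regular_def)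
  define z where "z t = of_real (\<alpha> t) * sgn (\<Sum>i\<in>{1..k}. u i)" for t
  have za: "z a = (\<Sum>i\<in>{1..k}. u i)"
    using \<alpha>a u(2) by (auto simp: z_def sgn_eq)
  have nz: "cmod (z t) = \<alpha> t" if "t \<in> {a..b}" for t
    using \<alpha>(2)[OF that] u(2) \<alpha>a by (auto simp: z_def norm_mult norm_sgn)
  show ?thesis
  proof (cases "\<exists>p\<in>{3..k}. \<exists>q\<in>{3..k}. Im (cnj (u p) * u q) \<noteq> 0")
    case True
    then obtain p q where pq: "p \<in> {3..k}" "q \<in> {3..k}" "Im (cnj (u p) * u q) \<noteq> 0" by blast
    \<comment> \<open>With angular speed 0 the edge 1 stays fixed, and \<open>shake\<close> leaves
      edge 2 alone, so they remain parallel.\<close>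
    have r: "{p, q, 1} \<subseteq> {1..k}" "p \<noteq> 1" "q \<noteq> 1" using pq by auto
    obtain c \<beta> where c: "a < c" "c \<le> b"
      and \<beta>: "\<And>t i. t \<in> {a..c} \<Longrightarrow> i \<in> {1..k} \<Longrightarrow> cmod (\<beta> t i) = l i"
      "\<And>t. t \<in> {a..c} \<Longrightarrow> (\<Sum>i\<in>{1..k}. \<beta> t i) = z t"
      "\<And>t i. t \<in> {a..c} \<Longrightarrow> i \<noteq> p \<Longrightarrow> i \<noteq> q \<Longrightarrow> i \<noteq> 1 \<Longrightarrow> \<beta> t i = u i"
      "\<And>t. t \<in> {a..c} \<Longrightarrow> \<beta> t 1 = cis (0 * (t - a)) * u 1"
      unfolding z_def
      by (rule shake[OF ab \<alpha>(1,2) \<alpha>a u(1,2) r pq(3), where N="{}" and \<sigma>=0]) blast+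
    define t where "t = (a + c) / 2"
    have t: "a < t" "t < b" "t \<in> {a..c}" "t \<in> {a..b}" using c by (auto simp: t_def)
    have "\<beta> t 1 = u 1" "\<beta> t 2 = u 2" using \<beta>(3)[OF t(3), of 2] \<beta>(4)[OF t(3)] pq by auto
    then show ?thesis using t \<beta>(1,2)[OF t(3)] nz[OF t(4)] u(3) by (intro exI[of _ t] exI[of _ "\<beta> t"]) auto
  next
    case False
    then have par3: "Im (cnj (u p) * u q) = 0" if "p \<in> {3..k}" "q \<in> {3..k}" for p q
      using that by blast
    have par12: "Im (cnj (u p) * u q) = 0" if "p \<in> {1,2}" "q \<in> {1,2}" for p q
      using that u(3) by (auto simp: mult.commute)
    obtain p q where pq: "p \<in> {1..k}" "q \<in> {1..k}" "Im (cnj (u p) * u q) \<noteq> 0"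
      using regular_not_two_lines[OF \<alpha>(3) u(1,2), of 0] by auto
    have k3: "k \<ge> 3"
    proof (rule ccontr)
      assume "\<not> k \<ge> 3"
      then have "p \<in> {1,2}" "q \<in> {1,2}" using pq by auto
      then show False using par12 pq by blast
    qed
    define V where "V = u 1 + u 2"
    \<comment> \<open>Otherwise the first two edges are parallel with sum 0 and the others are
      parallel as well, against regularity with \<open>m = 2\<close>.\<close>
    have V0: "V \<noteq> 0"
    proof
      assume "V = 0"
      moreover have "{1..2::nat} = {1,2}" by auto
      ultimately have "(\<Sum>i\<in>{1..2}. u i) = 0" by (simp add: V_def)
      then obtain p q where "p \<in> {1..k}" "q \<in> {1..k}" "Im (cnj (u p) * u q) \<noteq> 0" "p \<le> 2 \<longleftrightarrow> q \<le> 2"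
        using regular_not_two_lines[OF \<alpha>(3) u(1,2) k_ge_2] by blast
      moreover from this have "p \<in> {1,2} \<and> q \<in> {1,2} \<or> p \<in> {3..k} \<and> q \<in> {3..k}" by force
      ultimately show False using par3 par12 by blast
    qed
    \<comment> \<open>If \<open>u 3\<close> were parallel to \<open>V\<close>, then all edges would
      be parallel to \<open>V\<close>.\<close>
    have V3: "Im (cnj V * u 3) \<noteq> 0"
    proof
      assume V3: "Im (cnj V * u 3) = 0"
      have "u 3 \<noteq> 0" using u(1)[of 3] l_pos[of 3] k3 by auto
      moreover have "Im (cnj (u 3) * V) = 0" using V3 by (simp add: algebra_simps)
      ultimately have V: "Im (cnj V * u i) = 0" if "i \<in> {3..k}" for i
        using parallel_trans[of "u 3" V "u i"] par3[of 3 i] that k3 by auto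
      have V12: "Im (cnj V * u i) = 0" if "i \<in> {1,2}" for i
        using that u(3) by (auto simp: V_def algebra_simps)
      have "Im (cnj V * u i) = 0" if "i \<in> {1..k}" for i
      proof -
        have "i \<in> {1,2} \<or> i \<in> {3..k}" using that by auto
        then show ?thesis using V V12 by blast
      qed
      then show False using parallel_trans[OF V0] pq by blast
    qed
    define y where "y t = V + u 3 + (z t - (\<Sum>i\<in>{1..k}. u i))" for t
    have "continuous_on {a..b} y"
      unfolding y_def z_def by (intro continuous_intros \<alpha>(1))
    moreover have "y a = V + u 3" by (simp add: y_def za)
    ultimately obtain c A where c: "a < c" "c \<le> b"
      and A: "\<And>t. t \<in> {a..c} \<Longrightarrow> cmod (A t) = cmod V" "\<And>t. t \<in> {a..c} \<Longrightarrow> cmod (y t - A t) = cmod (u 3)"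
      using parallelogram_move[OF ab _ _ V3] by metis
    define t where "t = (a + c) / 2"
    have t: "a < t" "t < b" "t \<in> {a..c}" "t \<in> {a..b}" using c by (auto simp: t_def)
    \<comment> \<open>The rotation that carries \<open>V\<close> to its new position is applied to
      both summands of \<open>V\<close>, which keeps them parallel.\<close>
    define h where "h = A t / V"
    have h: "cmod h = 1" using A(1)[OF t(3)] V0 by (simp add: h_def norm_divide)
    define v where "v i = (if i = 1 then h * u 1 else if i = 2 then h * u 2 else if i = 3 then y t - A t
        else u i)" for i :: nat
    have "v i - u i = (if i = 1 then h * u 1 - u 1 else 0) + (if i = 2 then h * u 2 - u 2 else 0)
       + (if i = 3 then y t - A t - u 3 else 0)" for i
      by (auto simp: v_def)
    then have "(\<Sum>i\<in>{1..k}. v i - u i) = (h * u 1 - u 1) + (h * u 2 - u 2) + (y t - A t - u 3)"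
      using k3 by (simp add: sum.distrib)
    also have "\<dots> = h * V - A t + (z t - (\<Sum>i\<in>{1..k}. u i))"
      by (simp add: y_def V_def algebra_simps)
    also have "h * V = A t" using V0 by (simp add: h_def)
    finally have "(\<Sum>i\<in>{1..k}. v i) = z t" by (simp add: sum_subtractf)
    moreover have "cmod (v i) = l i" if "i \<in> {1..k}" for i
      using that u(1) h A(2)[OF t(3)] by (auto simp: v_def norm_mult)
    moreover have "cnj (v 1) * v 2 = (h * cnj h) * (cnj (u 1) * u 2)"
      by (simp add: v_def)
    then have "cnj (v 1) * v 2 = cnj (u 1) * u 2"
      using h by (simp add: complex_norm_square[symmetric])
    ultimately show ?thesis using t nz[OF t(4)] u(3) by (intro exI[of _ t] exI[of _ v]) auto
  qed
qed

section \<open>Joining two configurations with regular values\<close>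

text \<open>Both ends are moved to times \<open>c < t0 < r\<close> with positive diagonals, the
  right one by reversing time. In between, \<open>lifts_same_side\<close> suffices if the signs at 2
  agree; otherwise a flip is inserted.\<close>

lemma lifts_if_parallel_interior:
  assumes \<alpha>: "continuous_on {0..1} \<alpha>" "\<And>t. t \<in> {0..1} \<Longrightarrow> feasible (\<alpha> t)"
      "regular (\<alpha> 0)" "regular (\<alpha> 1)"
    and p: "\<And>i. i \<in> {1..k} \<Longrightarrow> cmod (p i) = l i" "cmod (\<Sum>i\<in>{1..k}. p i) = \<alpha> 0"
    and q: "\<And>i. i \<in> {1..k} \<Longrightarrow> cmod (q i) = l i" "cmod (\<Sum>i\<in>{1..k}. q i) = \<alpha> 1"
    and t0: "0 < t0" "t0 < 1"
    and u: "\<And>i. i \<in> {1..k} \<Longrightarrow> cmod (u i) = l i" "cmod (\<Sum>i\<in>{1..k}. u i) = \<alpha> t0"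
      "Im (cnj (u 1) * u 2) = 0"
  shows "lifts \<alpha> 0 1 p q"
proof -
  define \<alpha>' where "\<alpha>' t = \<alpha> (1 - t)" for t
  have \<alpha>': "continuous_on {0..1} \<alpha>'" "regular (\<alpha>' 0)" "\<alpha>' 0 = \<alpha> 1"
    unfolding \<alpha>'_def using \<alpha>(4)
    by (auto intro!: continuous_on_compose2[OF \<alpha>(1)] continuous_intros)
  obtain b where b: "0 < b" "b \<le> 1" "\<And>t. t \<in> {0..b} \<Longrightarrow> regular (\<alpha> t)"
    using regular_nbhd[OF \<alpha>(1,3)] by blast
  obtain b' where b': "0 < b'" "b' \<le> 1" "\<And>t. t \<in> {0..b'} \<Longrightarrow> regular (\<alpha>' t)"
    using regular_nbhd[OF \<alpha>'(1,2)] by blast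
  obtain c d e where c: "0 \<le> c" "c < min b t0" and d: "admissible d" "positive d" "d k = \<alpha> c" "signs e"
    "lifts \<alpha> 0 c p (config d e)"
    by (rule lifts_to_config[of "min b t0" \<alpha> p]) (use b t0 p \<alpha>(1) in \<open>auto elim: continuous_on_subset\<close>)
  obtain c' d' e' where c': "0 \<le> c'" "c' < min b' (1 - t0)"
    and d': "admissible d'" "positive d'" "d' k = \<alpha>' c'" "signs e'" "lifts \<alpha>' 0 c' q (config d' e')"
    by (rule lifts_to_config[of "min b' (1 - t0)" \<alpha>' q])
      (use b' t0 q \<alpha>' in \<open>auto elim: continuous_on_subset\<close>)
  define r where "r = 1 - c'"
  have r: "t0 < r" "r \<le> 1" "c < t0" "c < r" using c c' by (auto simp: r_def)
  have d'r: "d' k = \<alpha> r" using d'(3) by (simp add: r_def \<alpha>'_def)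
  have right: "lifts \<alpha> r 1 (config d' e') q"
    using lifts_reverse[of \<alpha> 0 c'] d'(5) by (simp add: r_def \<alpha>'_def[abs_def])
  have sub: "{s..s'} \<subseteq> {0..1}" if "c \<le> s" "s' \<le> r" for s s' using that c(1) r by auto
  have cont: "continuous_on {s..s'} \<alpha>" if "c \<le> s" "s' \<le> r" for s s'
    using continuous_on_subset[OF \<alpha>(1) sub[OF that]] .
  have feas: "feasible (\<alpha> t)" if "t \<in> {c..r}" for t
    using \<alpha>(2)[of t] that c(1) r by auto
  have "lifts \<alpha> c r (config d e) (config d' e')"
  proof (cases "e 2 = e' 2")
    case True
    show ?thesis
      by (rule lifts_same_side[OF r(4) cont _ d(1,2,3) d'(1,2) d'r d(4) d'(4) True]) (use feas in auto)
  next
    case False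
    have e2: "e 2 * e 2 = 1" "e' 2 * e' 2 = 1" using d(4) d'(4) by (auto simp: signs_def)
    then have neg: "e' 2 = - e 2" using False by (simp add: square_eq_iff flip: e2(1))
    have "flippable \<alpha> c r (e 2)"
      by (rule flippable_at[OF r(3,1) cont _ u e2(1)]) (use feas in auto)
    then obtain s s' f f' h h' where s: "c < s" "s \<le> s'" "s' < r"
      and f: "admissible f" "positive f" "f k = \<alpha> s" "admissible f'" "positive f'" "f' k = \<alpha> s'"
      and h: "signs h" "signs h'" "h 2 = e 2" "h' 2 = - e 2" "lifts \<alpha> s s' (config f h) (config f' h')"
      unfolding flippable_def by blast
    have "lifts \<alpha> c s (config d e) (config f h)"
      by (rule lifts_same_side[OF s(1) cont _ d(1,2,3) f(1,2,3) d(4) h(1)]) (use feas s h in auto)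
    moreover have "lifts \<alpha> s' r (config f' h') (config d' e')"
      by (rule lifts_same_side[OF s(3) cont _ f(4,5,6) d'(1,2) d'r h(2) d'(4)]) (use feas s h neg in auto)
    ultimately show ?thesis
      using h(5) lifts_trans s by (meson less_imp_le order_trans)
  qed
  then show ?thesis
    using lifts_trans[OF lifts_trans[OF d(5)] right] c(1) r by simp
qed

text \<open>If \<open>t0\<close> is an end of the interval, \<open>parallel_nearby\<close> supplies
  an interior time, for the end 1 with time reversed.\<close>

lemma lifts_if_parallel:
  assumes \<alpha>: "continuous_on {0..1} \<alpha>" "\<And>t. t \<in> {0..1} \<Longrightarrow> feasible (\<alpha> t)"
      "regular (\<alpha> 0)" "regular (\<alpha> 1)"
    and p: "\<And>i. i \<in> {1..k} \<Longrightarrow> cmod (p i) = l i" "cmod (\<Sum>i\<in>{1..k}. p i) = \<alpha> 0"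
    and q: "\<And>i. i \<in> {1..k} \<Longrightarrow> cmod (q i) = l i" "cmod (\<Sum>i\<in>{1..k}. q i) = \<alpha> 1"
    and t0: "t0 \<in> {0..1}"
    and u: "\<And>i. i \<in> {1..k} \<Longrightarrow> cmod (u i) = l i" "cmod (\<Sum>i\<in>{1..k}. u i) = \<alpha> t0"
      "Im (cnj (u 1) * u 2) = 0"
  shows "lifts \<alpha> 0 1 p q"
proof -
  have \<alpha>0: "\<alpha> t \<ge> 0" if "t \<in> {0..1}" for t using \<alpha>(2)[OF that] by (simp add: feasible_def)
  have "\<exists>t v. 0 < t \<and> t < 1 \<and> (\<forall>i\<in>{1..k}. cmod (v i) = l i) \<and> cmod (\<Sum>i\<in>{1..k}. v i) = \<alpha> t \<and>
    Im (cnj (v 1) * v 2) = 0"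
  proof -
    consider "t0 = 0" | "t0 = 1" | "0 < t0" "t0 < 1" using t0 by force
    then show ?thesis
    proof cases
      case 1
      then show ?thesis using parallel_nearby[OF _ \<alpha>(1) \<alpha>0 \<alpha>(3) u(1) _ u(3)] u(2) by auto
    next
      case 2
      have "continuous_on {0..1} (\<lambda>t. \<alpha> (1 - t))"
        by (auto intro!: continuous_on_compose2[OF \<alpha>(1)] continuous_intros)
      from parallel_nearby[OF _ this _ _ u(1) _ u(3)]
      obtain t v where "0 < t" "t < 1" "\<forall>i\<in>{1..k}. cmod (v i) = l i"
        "cmod (\<Sum>i\<in>{1..k}. v i) = \<alpha> (1 - t)" "Im (cnj (v 1) * v 2) = 0"
        using u(2) 2 \<alpha>(4) \<alpha>0 by auto
      then show ?thesis by (intro exI[of _ "1 - t"] exI[of _ v]) auto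
    next
      case 3
      then show ?thesis using u by blast
    qed
  qed
  then show ?thesis using lifts_if_parallel_interior[OF \<alpha> p q] by blast
qed

end

section \<open>The moduli space\<close>

lemma openin_quotient_topology:
  "openin (quotient_topology X f S) U \<longleftrightarrow> U \<subseteq> S \<and> openin X {x \<in> topspace X. f x \<in> U}"
proof -
  have "istopology (\<lambda>U. U \<subseteq> S \<and> openin X {x \<in> topspace X. f x \<in> U})"
    unfolding istopology_def
  proof (intro conjI allI impI)
    fix U V assume "U \<subseteq> S \<and> openin X {x \<in> topspace X. f x \<in> U}" "V \<subseteq> S \<and> openin X {x \<in> topspace X. f x \<in> V}"
    moreover have "{x \<in> topspace X. f x \<in> U \<inter> V} = {x \<in> topspace X. f x \<in> U} \<inter> {x \<in> topspace X. f x \<in> V}"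
      by auto
    ultimately show "U \<inter> V \<subseteq> S" "openin X {x \<in> topspace X. f x \<in> U \<inter> V}"
      by auto
  next
    fix K assume K: "\<forall>U\<in>K. U \<subseteq> S \<and> openin X {x \<in> topspace X. f x \<in> U}"
    have "{x \<in> topspace X. f x \<in> \<Union>K} = (\<Union>U\<in>K. {x \<in> topspace X. f x \<in> U})" by auto
    then show "\<Union>K \<subseteq> S" "openin X {x \<in> topspace X. f x \<in> \<Union>K}" using K by auto
  qed
  then show ?thesis by (simp add: quotient_topology_def topology_inverse')
qed

lemma topspace_quotient_topology:
  assumes "f ` topspace X \<subseteq> S"
  shows "topspace (quotient_topology X f S) = S"
proof
  show "topspace (quotient_topology X f S) \<subseteq> S"
    using openin_topspace[of "quotient_topology X f S"] unfolding openin_quotient_topology by blast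
  have "{x \<in> topspace X. f x \<in> S} = topspace X" using assms by auto
  then have "openin (quotient_topology X f S) S" by (simp add: openin_quotient_topology)
  then show "S \<subseteq> topspace (quotient_topology X f S)" by (rule openin_subset)
qed

lemma continuous_map_quotient_topology:
  assumes "f ` topspace X \<subseteq> S"
  shows "continuous_map X (quotient_topology X f S) f"
  using assms
  by (auto simp: continuous_map_def topspace_quotient_topology openin_quotient_topology)

section \<open>Edge vectors and equivalence classes\<close>

definition edge_vec :: "(nat \<Rightarrow> complex) \<Rightarrow> nat \<Rightarrow> complex" where
  "edge_vec p i = p (Suc i) - p i"

text \<open>Right inverse of \<open>edge_vec\<close> on \<open>1..k\<close> with vertex 1 at the
  origin; the value 0 off the vertices is what \<open>conf_space\<close> demands.\<close>

definition placement :: "nat \<Rightarrow> (nat \<Rightarrow> complex) \<Rightarrow> nat \<Rightarrow> complex" where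
  "placement k v n = (if n \<in> verts k then \<Sum>i\<in>{1..<n}. v i else 0)"

lemma edge_vec_placement: "i \<in> {1..k} \<Longrightarrow> edge_vec (placement k v) i = v i"
  by (simp add: edge_vec_def placement_def verts_def)

lemma sum_edge_vec: "n \<ge> 1 \<Longrightarrow> (\<Sum>i\<in>{1..<n}. edge_vec p i) = p n - p 1"
  by (induction n rule: dec_induct) (simp_all add: edge_vec_def)

lemma sum_edge_vec_all: "(\<Sum>i\<in>{1..k}. edge_vec p i) = p (k + 1) - p 1"
  using sum_edge_vec[of "k + 1" p] by (simp add: atLeastLessThanSuc_atLeastAtMost)

lemma conf_space_edge_vec:
  "p \<in> conf_space k l \<longleftrightarrow>
     (\<forall>n. n \<notin> verts k \<longrightarrow> p n = 0) \<and> (\<forall>i\<in>{1..k}. cmod (edge_vec p i) = l i)"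
  by (simp add: conf_space_def edge_vec_def norm_minus_commute)

lemma placement_in_conf_space:
  "(\<And>i. i \<in> {1..k} \<Longrightarrow> cmod (v i) = l i) \<Longrightarrow> placement k v \<in> conf_space k l"
  unfolding conf_space_edge_vec by (auto simp: edge_vec_placement) (auto simp: placement_def)

text \<open>An isometry \<open>a * z + b\<close> multiplies edge vectors by \<open>a\<close>;
  conversely, summing edges from vertex 1 recovers the translation.\<close>

lemma conf_rel_iff:
  "(p, q) \<in> conf_rel k l \<longleftrightarrow> p \<in> conf_space k l \<and> q \<in> conf_space k l \<and>
     (\<exists>c. cmod c = 1 \<and> (\<forall>i\<in>{1..k}. edge_vec q i = c * edge_vec p i))"
proof
  assume "(p, q) \<in> conf_rel k l"
  then obtain g where pq: "p \<in> conf_space k l" "q \<in> conf_space k l"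
    and g: "or_isometry g" "\<forall>n\<in>verts k. q n = g (p n)"
    by (auto simp: conf_rel_def)
  from g obtain a b where ab: "cmod a = 1" "\<forall>n\<in>verts k. q n = a * p n + b"
    unfolding or_isometry_def by metis
  then have "edge_vec q i = a * edge_vec p i" if "i \<in> {1..k}" for i
    using that by (simp add: edge_vec_def verts_def algebra_simps)
  then show "p \<in> conf_space k l \<and> q \<in> conf_space k l \<and>
     (\<exists>c. cmod c = 1 \<and> (\<forall>i\<in>{1..k}. edge_vec q i = c * edge_vec p i))" using ab pq by blast
next
  assume "p \<in> conf_space k l \<and> q \<in> conf_space k l \<and>
     (\<exists>c. cmod c = 1 \<and> (\<forall>i\<in>{1..k}. edge_vec q i = c * edge_vec p i))"
  then obtain c where c: "p \<in> conf_space k l" "q \<in> conf_space k l" "cmod c = 1"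
    "\<forall>i\<in>{1..k}. edge_vec q i = c * edge_vec p i" by blast
  have "q n = c * p n + (q 1 - c * p 1)" if n: "n \<in> verts k" for n
  proof -
    have n1: "n \<ge> 1" "{1..<n} \<subseteq> {1..k}" using n by (auto simp: verts_def)
    have "q n - q 1 = (\<Sum>i\<in>{1..<n}. edge_vec q i)" using sum_edge_vec[OF n1(1)] by simp
    also have "\<dots> = (\<Sum>i\<in>{1..<n}. c * edge_vec p i)" using c(4) n1(2) by (intro sum.cong) auto
    also have "\<dots> = c * (p n - p 1)"
      using sum_edge_vec[OF n1(1), of p] by (simp add: sum_distrib_left[symmetric])
    finally show ?thesis by (simp add: algebra_simps)
  qed
  moreover have "or_isometry (\<lambda>z. c * z + (q 1 - c * p 1))"
    unfolding or_isometry_def using c(3) by blast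
  ultimately have "\<exists>g. or_isometry g \<and> (\<forall>n\<in>verts k. q n = g (p n))" by blast
  then show "(p, q) \<in> conf_rel k l"
    using c(1,2) by (simp add: conf_rel_def)
qed

lemma equiv_conf_rel: "equiv (conf_space k l) (conf_rel k l)"
proof (rule equivI)
  show "conf_rel k l \<subseteq> conf_space k l \<times> conf_space k l" by (auto simp: conf_rel_def)
  show "refl_on (conf_space k l) (conf_rel k l)"
    by (rule refl_onI) (auto simp: conf_rel_iff intro!: exI[of _ 1])
  show "sym (conf_rel k l)"
  proof (rule symI)
    fix p q assume "(p, q) \<in> conf_rel k l"
    then obtain c where "p \<in> conf_space k l" "q \<in> conf_space k l" "cmod c = 1"
      "\<forall>i\<in>{1..k}. edge_vec q i = c * edge_vec p i" by (auto simp: conf_rel_iff)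
    moreover from this have "c \<noteq> 0" by auto
    ultimately show "(q, p) \<in> conf_rel k l"
      unfolding conf_rel_iff by (auto simp: norm_divide intro!: exI[of _ "1 / c"])
  qed
  show "trans (conf_rel k l)"
  proof (rule transI)
    fix p q r assume "(p, q) \<in> conf_rel k l" "(q, r) \<in> conf_rel k l"
    then obtain c c' where c: "p \<in> conf_space k l" "r \<in> conf_space k l" "cmod c = 1" "cmod c' = 1"
      "\<forall>i\<in>{1..k}. edge_vec q i = c * edge_vec p i" "\<forall>i\<in>{1..k}. edge_vec r i = c' * edge_vec q i"
      by (auto simp: conf_rel_iff)
    have "cmod (c' * c) = 1" "\<forall>i\<in>{1..k}. edge_vec r i = (c' * c) * edge_vec p i"
      using c by (auto simp: norm_mult)
    then show "(p, r) \<in> conf_rel k l" unfolding conf_rel_iff using c by blast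
  qed
qed

lemma moduli_memE:
  assumes "X \<in> moduli k l"
  shows "rep X \<in> conf_space k l" "conf_rel k l `` {rep X} = X"
proof -
  obtain p where p: "p \<in> conf_space k l" "X = conf_rel k l `` {p}"
    using assms by (auto simp: moduli_def elim: quotientE)
  have "p \<in> X" using p equiv_class_self[OF equiv_conf_rel] by blast
  then have "rep X \<in> X" unfolding rep_def by (rule someI[where P="\<lambda>p. p \<in> X"])
  then have r: "(p, rep X) \<in> conf_rel k l" using p by simp
  then show "rep X \<in> conf_space k l" by (simp add: conf_rel_iff)
  show "conf_rel k l `` {rep X} = X" using equiv_class_eq[OF equiv_conf_rel r] p by simp
qed

lemma class_in_moduli: "p \<in> conf_space k l \<Longrightarrow> conf_rel k l `` {p} \<in> moduli k l"
  by (simp add: moduli_def quotientI)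

lemma rep_class:
  assumes "p \<in> conf_space k l"
  obtains c where "cmod c = 1" "\<And>i. i \<in> {1..k} \<Longrightarrow> edge_vec (rep (conf_rel k l `` {p})) i = c * edge_vec p i"
proof -
  note m = moduli_memE[OF class_in_moduli[OF assms]]
  have "(p, rep (conf_rel k l `` {p})) \<in> conf_rel k l"
    using m eq_equiv_class[OF _ equiv_conf_rel, of k l p "rep (conf_rel k l `` {p})"] by auto
  then show thesis using that by (auto simp: conf_rel_iff)
qed

lemma theta_rep: "theta k X = cmod (\<Sum>i\<in>{1..k}. edge_vec (rep X) i)"
  unfolding sum_edge_vec_all theta_def by (simp add: norm_minus_commute)

lemma theta_class:
  assumes "p \<in> conf_space k l"
  shows "theta k (conf_rel k l `` {p}) = cmod (\<Sum>i\<in>{1..k}. edge_vec p i)"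
proof -
  obtain c where c: "cmod c = 1" "\<And>i. i \<in> {1..k} \<Longrightarrow> edge_vec (rep (conf_rel k l `` {p})) i = c * edge_vec p i"
    using rep_class[OF assms] by blast
  have "(\<Sum>i\<in>{1..k}. edge_vec (rep (conf_rel k l `` {p})) i) = c * (\<Sum>i\<in>{1..k}. edge_vec p i)"
    using c(2) by (simp add: sum_distrib_left)
  then show ?thesis unfolding theta_rep using c(1) by (simp only: norm_mult mult_1)
qed

text \<open>All edges are laid on the real axis with signs \<open>e\<close>. The chosen
  representative is an affine image of this placement, hence collinear too.\<close>

lemma critical_value_signed_sum:
  assumes e: "\<And>i. e i * e i = (1::real)" and l: "\<And>i. i \<in> {1..k} \<Longrightarrow> l i > 0"
  shows "critical_value k l \<bar>\<Sum>i\<in>{1..k}. e i * l i\<bar>"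
proof -
  define v where "v i = complex_of_real (e i * l i)" for i
  define p where "p = placement k v"
  have e1: "\<bar>e i\<bar> = 1" for i using e[of i] by (auto simp: square_eq_1_iff)
  have p: "p \<in> conf_space k l"
    unfolding p_def by (rule placement_in_conf_space) (use e1 l in \<open>auto simp: v_def abs_mult norm_mult less_imp_le\<close>)
  define X where "X = conf_rel k l `` {p}"
  have X: "X \<in> moduli k l" unfolding X_def using p by (rule class_in_moduli)
  have "(p, rep X) \<in> conf_rel k l"
    using moduli_memE[OF X] eq_equiv_class[OF _ equiv_conf_rel, of k l p "rep X"] by (auto simp: X_def)
  then obtain g where "or_isometry g" "\<forall>n\<in>verts k. rep X n = g (p n)"
    by (auto simp: conf_rel_def)
  then obtain a b where ab: "\<forall>n\<in>verts k. rep X n = a * p n + b"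
    unfolding or_isometry_def by metis
  have "collinear (rep X ` verts k)"
    unfolding collinear_def
  proof (intro exI[of _ a] ballI)
    fix x y assume "x \<in> rep X ` verts k" "y \<in> rep X ` verts k"
    then obtain m n where mn: "m \<in> verts k" "n \<in> verts k" "x = a * p m + b" "y = a * p n + b"
      using ab by auto
    have "x - y = ((\<Sum>i\<in>{1..<m}. e i * l i) - (\<Sum>i\<in>{1..<n}. e i * l i)) *\<^sub>R a"
      using mn by (simp add: p_def placement_def v_def scaleR_conv_of_real algebra_simps)
    then show "\<exists>c. x - y = c *\<^sub>R a" by blast
  qed
  moreover have "theta k X = \<bar>\<Sum>i\<in>{1..k}. e i * l i\<bar>"
  proof -
    have "(\<Sum>i\<in>{1..k}. edge_vec p i) = of_real (\<Sum>i\<in>{1..k}. e i * l i)"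
      unfolding p_def by (simp add: edge_vec_placement v_def)
    then show ?thesis unfolding X_def theta_class[OF p] by (simp only: norm_of_real)
  qed
  ultimately show ?thesis using X unfolding critical_value_def critical_point_def by blast
qed

lemma openin_moduli_top:
  assumes "U \<subseteq> moduli k l"
    "openin (top_of_set (conf_space k l)) {p \<in> conf_space k l. conf_rel k l `` {p} \<in> U}"
  shows "openin (moduli_top k l) U"
  using assms by (simp add: moduli_top_def openin_quotient_topology)

text \<open>The orientation of the edges \<open>i\<close> and \<open>j\<close> is invariant under rotations and changes under
  reflection; hence it disconnects every fibre on which it never degenerates.\<close>
lemma nabla_parallel:
  assumes x: "x \<in> nabla k l" and ij: "i \<in> {1..k}" "j \<in> {1..k}"
  obtains v where "\<And>n. n \<in> {1..k} \<Longrightarrow> cmod (v n) = l n" "cmod (\<Sum>n\<in>{1..k}. v n) = x"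
    "Im (cnj (v i) * v j) = 0"
proof (rule ccontr)
  assume no: "\<not> thesis"
  note fibre = that
  define \<phi> where "\<phi> p = Im (cnj (edge_vec p i) * edge_vec p j)" for p
  define U where "U s = {X \<in> moduli k l. s * \<phi> (rep X) > 0}" for s :: real
  define F where "F = {X \<in> moduli k l. theta k X = x}"
  have \<phi>_rel: "\<phi> (rep (conf_rel k l `` {p})) = \<phi> p" if p: "p \<in> conf_space k l" for p
  proof -
    obtain c where c: "cmod c = 1" "\<And>i. i \<in> {1..k} \<Longrightarrow> edge_vec (rep (conf_rel k l `` {p})) i = c * edge_vec p i"
      using rep_class[OF p] by blast
    have "cnj (c * edge_vec p i) * (c * edge_vec p j) = (c * cnj c) * (cnj (edge_vec p i) * edge_vec p j)"
      by simp
    also have "c * cnj c = 1" using c(1) by (simp add: complex_norm_square[symmetric])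
    finally show ?thesis unfolding \<phi>_def c(2)[OF ij(1)] c(2)[OF ij(2)] by (simp only: mult_1)
  qed
  have \<phi>_cont: "continuous_on S \<phi>" for S
  proof -
    have "continuous_on S (\<lambda>p::nat \<Rightarrow> complex. p n)" for n
      by (rule continuous_on_product_then_coordinatewise) (rule continuous_on_id)
    then show ?thesis unfolding \<phi>_def edge_vec_def by (intro continuous_intros)
  qed
  \<comment> \<open>Since \<phi> is constant on classes, the preimage of \<open>U s\<close> in the
    configuration space is given by the sign of \<phi> itself.\<close>
  have U_open: "openin (moduli_top k l) (U s)" for s
  proof (rule openin_moduli_top)
    have "{p \<in> conf_space k l. conf_rel k l `` {p} \<in> U s} = conf_space k l \<inter> (\<lambda>p. s * \<phi> p) -` {0<..}"
      using \<phi>_rel class_in_moduli by (auto simp: U_def)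
    moreover have "openin (top_of_set (conf_space k l)) (conf_space k l \<inter> (\<lambda>p. s * \<phi> p) -` {0<..})"
      by (rule continuous_openin_preimage_gen) (auto intro!: continuous_intros \<phi>_cont)
    ultimately show "openin (top_of_set (conf_space k l)) {p \<in> conf_space k l. conf_rel k l `` {p} \<in> U s}"
      by simp
  qed (auto simp: U_def)
  have nz: "\<phi> (rep X) \<noteq> 0" if X: "X \<in> F" for X
  proof
    assume "\<phi> (rep X) = 0"
    moreover have "rep X \<in> conf_space k l" "cmod (\<Sum>i\<in>{1..k}. edge_vec (rep X) i) = x"
      using X moduli_memE unfolding F_def theta_rep by auto
    ultimately show False using no fibre[of "edge_vec (rep X)"] by (auto simp: conf_space_edge_vec \<phi>_def)
  qed
  have mirror: "\<exists>Y\<in>F. \<phi> (rep Y) = - \<phi> (rep X)" if X: "X \<in> F" for X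
  proof -
    define v where "v n = cnj (edge_vec (rep X) n)" for n
    have r: "rep X \<in> conf_space k l" using X moduli_memE by (auto simp: F_def)
    have p: "placement k v \<in> conf_space k l"
      by (rule placement_in_conf_space) (use r in \<open>auto simp: v_def conf_space_edge_vec\<close>)
    have "theta k (conf_rel k l `` {placement k v}) = cmod (\<Sum>i\<in>{1..k}. v i)"
      unfolding theta_class[OF p] by (simp add: edge_vec_placement)
    also have "\<dots> = cmod (cnj (\<Sum>i\<in>{1..k}. edge_vec (rep X) i))" by (simp add: v_def)
    also have "\<dots> = x" unfolding complex_mod_cnj using X by (simp add: F_def theta_rep)
    finally have "conf_rel k l `` {placement k v} \<in> F" using class_in_moduli[OF p] by (simp add: F_def)
    moreover have "\<phi> (rep (conf_rel k l `` {placement k v})) = - \<phi> (rep X)"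
      unfolding \<phi>_rel[OF p] using ij by (simp add: \<phi>_def edge_vec_placement v_def)
    ultimately show ?thesis by blast
  qed
  obtain X0 where X0: "X0 \<in> F" using x by (auto simp: nabla_def range_P_def F_def)
  then obtain Y0 where Y0: "Y0 \<in> F" "\<phi> (rep Y0) = - \<phi> (rep X0)" using mirror by blast
  have FU: "F \<subseteq> U 1 \<union> U (-1)" using nz by (force simp: U_def F_def)
  have "U 1 \<inter> U (-1) \<inter> F = {}" by (auto simp: U_def)
  moreover have "U 1 \<inter> F \<noteq> {}" "U (-1) \<inter> F \<noteq> {}"
  proof -
    have "X0 \<in> U 1 \<inter> F \<and> Y0 \<in> U (-1) \<inter> F \<or> Y0 \<in> U 1 \<inter> F \<and> X0 \<in> U (-1) \<inter> F"
      using X0 Y0 nz[OF X0] by (auto simp: U_def F_def)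
    then show "U 1 \<inter> F \<noteq> {}" "U (-1) \<inter> F \<noteq> {}" by blast+
  qed
  ultimately have "\<not> connectedin (moduli_top k l) F"
    using U_open FU unfolding connectedin by blast
  then show False using x by (simp add: nabla_def F_def)
qed

section \<open>Reordering the edges and conclusion\<close>

text \<open>One transposition brings a longest edge to place 1, the other a longest of the remaining
  ones to place 2, without touching place 1.\<close>

lemma ex_two_longest_first:
  fixes l :: "nat \<Rightarrow> real"
  assumes k: "k \<ge> 2" and l: "\<forall>i\<in>{1..k}. l i > 0"
  obtains \<pi> where "bij_betw \<pi> {1..k} {1..k}" "linkage k (\<lambda>i. l (\<pi> i))"
proof -
  have max: "\<exists>m\<in>S. \<forall>i\<in>S. f i \<le> f m" if S: "finite S" "S \<noteq> {}" for S and f :: "nat \<Rightarrow> real"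
  proof -
    have "Max (f ` S) \<in> f ` S" using S by (intro Max_in) auto
    then obtain m where "m \<in> S" "f m = Max (f ` S)" by (metis imageE)
    then show ?thesis using S by (intro bexI[of _ m]) auto
  qed
  obtain m where m: "m \<in> {1..k}" "\<And>i. i \<in> {1..k} \<Longrightarrow> l i \<le> l m"
    using max[of "{1..k}" l] k by auto
  define l' where "l' i = l (Transposition.transpose 1 m i)" for i
  obtain n where n: "n \<in> {2..k}" "\<And>i. i \<in> {2..k} \<Longrightarrow> l' i \<le> l' n"
    using max[of "{2..k}" l'] k by auto
  have b: "bij_betw (Transposition.transpose c d) {1..k} {1..k}" if "c \<in> {1..k}" "d \<in> {1..k}" for c d
    using that by (auto simp: bij_betw_def inj_on_def Transposition.transpose_def image_def split: if_splits)
  show thesis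
  proof (rule that)
    show "bij_betw (Transposition.transpose 1 m \<circ> Transposition.transpose 2 n) {1..k} {1..k}"
      by (rule bij_betw_trans[OF b b]) (use m n k in auto)
    have tr: "Transposition.transpose c d i \<in> {1..k}" if "c \<in> {1..k}" "d \<in> {1..k}" "i \<in> {1..k}" for c d i
      using that by (auto simp: Transposition.transpose_def)
    show "linkage k (\<lambda>i. l ((Transposition.transpose 1 m \<circ> Transposition.transpose 2 n) i))"
    proof
      show "2 \<le> k" by (rule k)
      show "0 < l ((Transposition.transpose 1 m \<circ> Transposition.transpose 2 n) i)" if "i \<in> {1..k}" for i
        using l tr[of 1 m] tr[of 2 n i] m(1) n(1) k that by auto
      show "l ((Transposition.transpose 1 m \<circ> Transposition.transpose 2 n) 2) \<le> l ((Transposition.transpose 1 m \<circ> Transposition.transpose 2 n) 1)"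
        using m(2)[of "Transposition.transpose 1 m n"] tr[of 1 m n] m(1) n(1) k by (simp add: Transposition.transpose_def)
      show "l ((Transposition.transpose 1 m \<circ> Transposition.transpose 2 n) i) \<le> l ((Transposition.transpose 1 m \<circ> Transposition.transpose 2 n) 2)"
        if "i \<in> {3..k}" for i
        using n(2)[of "Transposition.transpose 2 n i"] n(1) that by (auto simp: l'_def Transposition.transpose_def)
    qed
  qed
qed

theorem mainTheorem7:
  fixes k :: nat and l :: "nat \<Rightarrow> real"
    and p q :: "(nat \<Rightarrow> complex) set" and \<alpha> :: "real \<Rightarrow> real"
  assumes "k \<ge> 2"
    and "\<forall>i\<in>{1..k}. l i > 0"
    and "p \<in> moduli k l" and "q \<in> moduli k l"
    and "\<not> critical_value k l (theta k p)" and "\<not> critical_value k l (theta k q)"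
    and "continuous_on {0..1} \<alpha>" and "\<alpha> ` {0..1} \<subseteq> range_P k l"
    and "\<alpha> 0 = theta k p" and "\<alpha> 1 = theta k q"
    and "\<alpha> ` {0..1} \<inter> nabla k l \<noteq> {}"
  shows "\<exists>\<beta>. continuous_map (top_of_set {0..1::real}) (moduli_top k l) \<beta> \<and>
             \<beta> 0 = p \<and> \<beta> 1 = q \<and> (\<forall>t\<in>{0..1}. theta k (\<beta> t) = \<alpha> t)"
proof -
  obtain \<pi> where \<pi>: "bij_betw \<pi> {1..k} {1..k}" "linkage k (\<lambda>i. l (\<pi> i))"
    using ex_two_longest_first assms(1,2) by blast
  \<comment> \<open>From here on edge vectors are listed in the order \<pi>, which leaves their sum
    unchanged.\<close>
  interpret linkage k "\<lambda>i. l (\<pi> i)" by (rule \<pi>(2))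
  define \<rho> where "\<rho> = the_inv_into {1..k} \<pi>"
  have \<pi>_in: "\<pi> i \<in> {1..k}" if "i \<in> {1..k}" for i
    using \<pi>(1) that by (auto simp: bij_betw_def)
  have \<rho>: "bij_betw \<rho> {1..k} {1..k}" "\<And>i. i \<in> {1..k} \<Longrightarrow> \<pi> (\<rho> i) = i"
    using bij_betw_the_inv_into[OF \<pi>(1)] f_the_inv_into_f_bij_betw[OF \<pi>(1)] by (auto simp: \<rho>_def)
  have \<rho>\<pi>: "\<rho> (\<pi> i) = i" if "i \<in> {1..k}" for i
    using the_inv_into_f_f[of \<pi> "{1..k}" i] \<pi>(1) that by (auto simp: \<rho>_def bij_betw_def)
  have \<rho>_in: "\<rho> i \<in> {1..k}" if "i \<in> {1..k}" for i
    using \<rho>(1) that by (auto simp: bij_betw_def)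
  have sum_\<pi>: "(\<Sum>i\<in>{1..k}. f (\<pi> i)) = (\<Sum>i\<in>{1..k}. f i)" for f :: "nat \<Rightarrow> complex"
    by (rule sum.reindex_bij_betw[OF \<pi>(1)])
  \<comment> \<open>A signed sum of the reordered lengths is one of the original lengths, with the
    signs permuted by \<rho>, and hence a critical value.\<close>
  have reg: "regular (theta k X)" if "X \<in> moduli k l" "\<not> critical_value k l (theta k X)" for X
    unfolding regular_def
  proof (intro conjI allI impI notI)
    have "theta k X \<noteq> 0" using that by (auto simp: critical_value_def critical_point_def)
    then show "theta k X > 0" by (simp add: theta_def)
    fix e assume e: "signs e" "\<bar>\<Sum>i\<in>{1..k}. e i * l (\<pi> i)\<bar> = theta k X"
    have "(\<Sum>i\<in>{1..k}. e i * l (\<pi> i)) = (\<Sum>i\<in>{1..k}. e (\<rho> (\<pi> i)) * l (\<pi> i))"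
      by (intro sum.cong) (auto simp: \<rho>\<pi>)
    also have "\<dots> = (\<Sum>i\<in>{1..k}. e (\<rho> i) * l i)"
      by (rule sum.reindex_bij_betw[OF \<pi>(1)])
    finally show False
      using critical_value_signed_sum[of "\<lambda>i. e (\<rho> i)" k l] e assms(2) that(2) by (auto simp: signs_def)
  qed
  have len: "cmod (edge_vec (rep X) (\<pi> i)) = l (\<pi> i)" if "X \<in> moduli k l" "i \<in> {1..k}" for X i
    using moduli_memE(1)[OF that(1)] \<pi>_in[OF that(2)] by (simp add: conf_space_edge_vec)
  have th: "cmod (\<Sum>i\<in>{1..k}. edge_vec (rep X) (\<pi> i)) = theta k X" for X
    unfolding sum_\<pi> by (simp add: theta_rep)
  have feas: "feasible (\<alpha> t)" if t: "t \<in> {0..1}" for t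
  proof -
    have "\<alpha> t \<in> theta k ` moduli k l"
      using assms(8) t unfolding range_P_def by blast
    then obtain X where X: "X \<in> moduli k l" "\<alpha> t = theta k X" by blast
    show ?thesis
      using admissible_feasible[OF sums_admissible[OF len[OF X(1)]]] X(2) th by simp
  qed
  obtain t0 where t0: "t0 \<in> {0..1}" "\<alpha> t0 \<in> nabla k l" using assms(11) by blast
  have 12: "\<pi> 1 \<in> {1..k}" "\<pi> 2 \<in> {1..k}" using \<pi>_in assms(1) by auto
  obtain v where v: "\<And>n. n \<in> {1..k} \<Longrightarrow> cmod (v n) = l n" "cmod (\<Sum>n\<in>{1..k}. v n) = \<alpha> t0"
    "Im (cnj (v (\<pi> 1)) * v (\<pi> 2)) = 0"
    using nabla_parallel[OF t0(2) 12] by blast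
  have "lifts \<alpha> 0 1 (\<lambda>i. edge_vec (rep p) (\<pi> i)) (\<lambda>i. edge_vec (rep q) (\<pi> i))"
  proof (rule lifts_if_parallel[OF assms(7) feas _ _ len[OF assms(3)] _ len[OF assms(4)] _ t0(1)])
    show "cmod (v (\<pi> i)) = l (\<pi> i)" if "i \<in> {1..k}" for i using v(1) \<pi>_in[OF that] .
    show "cmod (\<Sum>i\<in>{1..k}. v (\<pi> i)) = \<alpha> t0" unfolding sum_\<pi> by (rule v(2))
    show "Im (cnj (v (\<pi> 1)) * v (\<pi> 2)) = 0" by (rule v(3))
    show "regular (\<alpha> 0)" "regular (\<alpha> 1)" using reg assms by auto
    show "cmod (\<Sum>i\<in>{1..k}. edge_vec (rep p) (\<pi> i)) = \<alpha> 0"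
      "cmod (\<Sum>i\<in>{1..k}. edge_vec (rep q) (\<pi> i)) = \<alpha> 1"
      using th assms(9,10) by auto
  qed
  then obtain \<gamma> c c' where \<gamma>: "\<And>i. i\<in>{1..k} \<Longrightarrow> continuous_on {0..1} (\<lambda>t. \<gamma> t i)"
     "\<forall>t\<in>{0..1}. (\<forall>i\<in>{1..k}. cmod (\<gamma> t i) = l (\<pi> i)) \<and> cmod (\<Sum>i\<in>{1..k}. \<gamma> t i) = \<alpha> t"
     "cmod c = 1" "\<forall>i\<in>{1..k}. \<gamma> 0 i = c * edge_vec (rep p) (\<pi> i)"
     "cmod c' = 1" "\<forall>i\<in>{1..k}. \<gamma> 1 i = c' * edge_vec (rep q) (\<pi> i)"
    unfolding lifts_def by blast
  \<comment> \<open>\<rho> restores the original order of the edges. Continuity is shown for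
    placements and then passes to the quotient.\<close>
  define P where "P t = placement k (\<lambda>i. \<gamma> t (\<rho> i))" for t
  define \<beta> where "\<beta> t = conf_rel k l `` {P t}" for t
  have P: "P t \<in> conf_space k l" if "t \<in> {0..1}" for t
    unfolding P_def by (rule placement_in_conf_space) (use \<gamma>(2) that \<rho>(2) \<rho>_in in auto)
  have edge_P: "edge_vec (P t) i = \<gamma> t (\<rho> i)" if "i \<in> {1..k}" for t i
    unfolding P_def using edge_vec_placement[OF that] .
  \<comment> \<open>The ends of the lift are rotated copies of the representatives, so their classes
    are the prescribed points.\<close>
  have start: "conf_rel k l `` {P t} = X"
    if "t \<in> {0..1}" "X \<in> moduli k l" "cmod c = 1" "\<forall>i\<in>{1..k}. \<gamma> t i = c * edge_vec (rep X) (\<pi> i)" for t X c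
  proof -
    have "(rep X, P t) \<in> conf_rel k l"
      unfolding conf_rel_iff
      using moduli_memE(1)[OF that(2)] P[OF that(1)] that(3,4) edge_P \<rho>_in \<rho>(2)
      by (intro conjI exI[of _ c] ballI) auto
    then show ?thesis using equiv_class_eq[OF equiv_conf_rel] moduli_memE(2)[OF that(2)] by metis
  qed
  have "continuous_on {0..1} P"
  proof (rule continuous_on_coordinatewise_then_product)
    fix n
    show "continuous_on {0..1} (\<lambda>t. P t n)"
    proof (cases "n \<in> verts k")
      case True
      then have "i \<in> {1..k}" if "i \<in> {1..<n}" for i using that by (auto simp: verts_def)
      then show ?thesis using True \<gamma>(1) \<rho>_in by (auto simp: P_def placement_def intro!: continuous_intros)
    qed (simp add: P_def placement_def)
  qed
  then have P_cont: "continuous_map (top_of_set {0..1}) (top_of_set (conf_space k l)) P"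
    using P by (auto simp: continuous_map_in_subtopology)
  have class_cont: "continuous_map (top_of_set (conf_space k l)) (moduli_top k l) (\<lambda>p. conf_rel k l `` {p})"
    unfolding moduli_top_def
    by (rule continuous_map_quotient_topology) (auto intro: class_in_moduli)
  have "continuous_map (top_of_set {0..1}) (moduli_top k l) \<beta>"
    using continuous_map_compose[OF P_cont class_cont] by (simp add: \<beta>_def[abs_def] o_def)
  moreover have "\<beta> 0 = p" "\<beta> 1 = q"
    unfolding \<beta>_def using start[OF _ assms(3) \<gamma>(3,4)] start[OF _ assms(4) \<gamma>(5,6)] by auto
  moreover have "theta k (\<beta> t) = \<alpha> t" if t: "t \<in> {0..1}" for t
  proof -
    have "(\<Sum>i\<in>{1..k}. edge_vec (P t) i) = (\<Sum>i\<in>{1..k}. \<gamma> t (\<rho> i))"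
      by (intro sum.cong) (auto simp: edge_P)
    also have "\<dots> = (\<Sum>i\<in>{1..k}. \<gamma> t i)" by (rule sum.reindex_bij_betw[OF \<rho>(1)])
    finally show ?thesis unfolding \<beta>_def theta_class[OF P[OF t]] using \<gamma>(2) t by simp
  qed
  ultimately show ?thesis by blast
qed

end
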